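(* Let $X$ be a metric space which coarsely embeds into a Hilbert space, let $k>0$ be an integer, and let $\mathcal{E}^k X$ be the space of unordered $k$-tuples of points in $X$ (equivalently, the space of empirical measures of size $k$ on $X$) with the $1$-Wasserstein distance. Then $\mathcal{E}^k X$ coarsely embeds into a Hilbert space.
   Context: A map $f: X\to Y$ between metric spaces is a coarse embedding if there are non-decreasing functions $\rho_-,\rho_+:[0,\infty)\to[0,\infty)$ with $\lim_{t\to\infty}\rho_-(t)=\infty$ such that $\rho_-(d(x,x'))\le d(f(x),f(x'))\le \rho_+(d(x,x'))$ for all $x,x'\in X$. A metric space coarsely embeds into a Hilbert space if there exist a (real) Hilbert space $H$ and a coarse embedding $X\to H$. An empirical measure of size $k$ on $X$ is a measure of the form $\frac1k\sum_{i=1}^k\delta_{x_i}$ with $x_1,\dots,x_k\in X$ (not necessarily distinct). $\mathcal{E}^kX$ is the set of empirical measures of size $k$ on $X$ with the $1$-Wasserstein distance, which for $\alpha=\frac1k\sum_{i=1}^k\delta_{x_i}$ and $\beta=\frac1k\sum_{i=1}^k\delta_{y_i}$ is $W_1(\alpha,\beta)=\frac1k\min_\pi\sum_{i=1}^k d(x_i,y_{\pi(i)})$, where $\pi$ ranges over all bijections $\{1,\dots,k\}\to\{1,\dots,k\}$. *)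

theory Defs
  imports "HOL-Analysis.Analysis" "HOL-Combinatorics.Permutations"
begin

section \<open>Real Hilbert spaces on a carrier\<close>

text \<open>
  The library's Hilbert spaces are types of class \<open>real_inner\<close> and \<open>complete_space\<close>. An existential
  quantifier over Hilbert spaces inside a formula cannot range over types, so we use the
  same axioms relative to a carrier set.
\<close>

locale real_inner_space =
  fixes H :: "'h set"
    and add :: "'h \<Rightarrow> 'h \<Rightarrow> 'h"
    and zero :: 'h
    and scal :: "real \<Rightarrow> 'h \<Rightarrow> 'h"
    and inn :: "'h \<Rightarrow> 'h \<Rightarrow> real"
  assumes add_closed: "\<lbrakk>x \<in> H; y \<in> H\<rbrakk> \<Longrightarrow> add x y \<in> H"
    and zero_closed: "zero \<in> H"
    and scal_closed: "x \<in> H \<Longrightarrow> scal a x \<in> H"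
    and add_assoc: "\<lbrakk>x \<in> H; y \<in> H; z \<in> H\<rbrakk> \<Longrightarrow> add (add x y) z = add x (add y z)"
    and add_commute: "\<lbrakk>x \<in> H; y \<in> H\<rbrakk> \<Longrightarrow> add x y = add y x"
    and add_zero: "x \<in> H \<Longrightarrow> add zero x = x"
    and add_minus: "x \<in> H \<Longrightarrow> add x (scal (-1) x) = zero"
    and scal_add_right: "\<lbrakk>x \<in> H; y \<in> H\<rbrakk> \<Longrightarrow> scal a (add x y) = add (scal a x) (scal a y)"
    and scal_add_left: "x \<in> H \<Longrightarrow> scal (a + b) x = add (scal a x) (scal b x)"
    and scal_scal: "x \<in> H \<Longrightarrow> scal a (scal b x) = scal (a * b) x"
    and scal_one: "x \<in> H \<Longrightarrow> scal 1 x = x"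
    and inn_commute: "\<lbrakk>x \<in> H; y \<in> H\<rbrakk> \<Longrightarrow> inn x y = inn y x"
    and inn_add_left: "\<lbrakk>x \<in> H; y \<in> H; z \<in> H\<rbrakk> \<Longrightarrow> inn (add x y) z = inn x z + inn y z"
    and inn_scal_left: "\<lbrakk>x \<in> H; y \<in> H\<rbrakk> \<Longrightarrow> inn (scal a x) y = a * inn x y"
    and inn_ge_zero: "x \<in> H \<Longrightarrow> 0 \<le> inn x x"
    and inn_eq_zero_iff: "x \<in> H \<Longrightarrow> inn x x = 0 \<longleftrightarrow> x = zero"

definition hdist ::
    "('h \<Rightarrow> 'h \<Rightarrow> 'h) \<Rightarrow> (real \<Rightarrow> 'h \<Rightarrow> 'h) \<Rightarrow> ('h \<Rightarrow> 'h \<Rightarrow> real) \<Rightarrow> 'h \<Rightarrow> 'h \<Rightarrow> real" where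
  "hdist add scal inn x y =
     (let v = add x (scal (-1) y) in sqrt (inn v v))"

locale real_hilbert_space = real_inner_space +
  assumes complete:
    "\<And>s :: nat \<Rightarrow> 'a.
       \<lbrakk>\<forall>n. s n \<in> H;
        \<forall>e>0. \<exists>N. \<forall>m\<ge>N. \<forall>n\<ge>N. hdist add scal inn (s m) (s n) < e\<rbrakk>
       \<Longrightarrow> \<exists>l\<in>H. (\<lambda>n. hdist add scal inn (s n) l) \<longlonglongrightarrow> 0"

lemma hdist_UNIV: "hdist (+) (*\<^sub>R) (\<bullet>) x y = dist x y"
  for x y :: "'h :: real_inner"
  by (simp add: hdist_def Let_def norm_eq_sqrt_inner dist_norm)

lemma real_hilbert_space_UNIV:
  "real_hilbert_space (UNIV :: 'h :: {real_inner, complete_space} set) (+) 0 (*\<^sub>R) (\<bullet>)"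
proof (unfold_locales, goal_cases)
  case (17 s)
  then have "Cauchy s"
    by (simp add: hdist_UNIV Cauchy_def)
  then obtain l where "s \<longlonglongrightarrow> l"
    using Cauchy_convergent_iff convergent_def by blast
  then have "(\<lambda>n. dist (s n) l) \<longlonglongrightarrow> 0"
    by (rule iffD1[OF tendsto_dist_iff])
  then show ?case
    by (auto simp: hdist_UNIV)
qed (auto simp: algebra_simps inner_commute)


section \<open>Coarse embeddings\<close>

definition coarse_embedding ::
    "'a set \<Rightarrow> ('a \<Rightarrow> 'a \<Rightarrow> real) \<Rightarrow> 'b set \<Rightarrow> ('b \<Rightarrow> 'b \<Rightarrow> real) \<Rightarrow> ('a \<Rightarrow> 'b) \<Rightarrow> bool" where
  "coarse_embedding X dX Y dY f \<longleftrightarrow>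
     f \<in> X \<rightarrow> Y \<and>
     (\<exists>rho_minus rho_plus :: real \<Rightarrow> real.
        rho_minus \<in> {0..} \<rightarrow> {0..} \<and> rho_plus \<in> {0..} \<rightarrow> {0..} \<and>
        mono_on {0..} rho_minus \<and> mono_on {0..} rho_plus \<and>
        filterlim rho_minus at_top at_top \<and>
        (\<forall>x\<in>X. \<forall>x'\<in>X. rho_minus (dX x x') \<le> dY (f x) (f x') \<and>
                       dY (f x) (f x') \<le> rho_plus (dX x x')))"

text \<open>
  The type argument is the type in which the carrier of the Hilbert space lives. For a metric
  space on \<open>X :: 'a set\<close>, the choice \<open>'a \<Rightarrow> real\<close> is no restriction: the closed
  linear span of the image of \<open>X\<close> has Hilbert dimension at most the cardinality of \<open>X\<close>, so it is isometric to a closed subspace of the square-summable functions \<open>'a \<Rightarrow> real\<close>.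
\<close>

definition coarsely_embeds_into_hilbert ::
    "'h itself \<Rightarrow> 'a set \<Rightarrow> ('a \<Rightarrow> 'a \<Rightarrow> real) \<Rightarrow> bool" where
  "coarsely_embeds_into_hilbert (_ :: 'h itself) X d \<longleftrightarrow>
     (\<exists>(H :: 'h set) add zero scal inn f.
        real_hilbert_space H add zero scal inn \<and>
        coarse_embedding X d H (hdist add scal inn) f)"


section \<open>Unordered tuples and the 1-Wasserstein distance\<close>

definition unordered_tuples :: "nat \<Rightarrow> 'a set \<Rightarrow> 'a multiset set" where
  "unordered_tuples k X = {A. size A = k \<and> set_mset A \<subseteq> X}"

definition wasserstein1_list :: "('a \<Rightarrow> 'a \<Rightarrow> real) \<Rightarrow> 'a list \<Rightarrow> 'a list \<Rightarrow> real" where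
  "wasserstein1_list d xs ys =
     (1 / real (length xs)) *
     Min ((\<lambda>p. \<Sum>i<length xs. d (xs ! i) (ys ! p i)) ` {p. p permutes {..<length xs}})"

text \<open>
  The enumerations of the two multisets are chosen arbitrarily; lemma \<open>wasserstein1_mset\<close> shows
  that the choice does not matter. The value \<open>0\<close> for multisets of different sizes is
  a dummy value, which makes the function symmetric as \<open>Metric_space\<close> demands outside the
  carrier too.
\<close>

definition wasserstein1 :: "('a \<Rightarrow> 'a \<Rightarrow> real) \<Rightarrow> 'a multiset \<Rightarrow> 'a multiset \<Rightarrow> real" where
  "wasserstein1 d A B =
     (if size A = size B
      then wasserstein1_list d (SOME xs. mset xs = A) (SOME ys. mset ys = B)
      else 0)"

lemma wasserstein1_list_le:
  assumes "p permutes {..<length xs}"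
  shows "wasserstein1_list d xs ys \<le> (1 / real (length xs)) * (\<Sum>i<length xs. d (xs ! i) (ys ! p i))"
  unfolding wasserstein1_list_def
  by (intro mult_left_mono Min_le) (use assms in \<open>auto simp: finite_permutations\<close>)

lemma wasserstein1_list_attained:
  obtains p where "p permutes {..<length xs}"
    "wasserstein1_list d xs ys = (1 / real (length xs)) * (\<Sum>i<length xs. d (xs ! i) (ys ! p i))"
proof -
  let ?S = "(\<lambda>p. \<Sum>i<length xs. d (xs ! i) (ys ! p i)) ` {p. p permutes {..<length xs}}"
  have "id permutes {..<length xs}" by (rule permutes_id)
  then have "?S \<noteq> {}" by blast
  then have "Min ?S \<in> ?S" by (intro Min_in) (auto simp: finite_permutations)
  then show ?thesis using that unfolding wasserstein1_list_def by auto
qed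

lemma wasserstein1_list_permute_le:
  assumes p: "p permutes {..<length xs}" and q: "q permutes {..<length ys}"
    and len: "length xs = length ys"
  shows "wasserstein1_list d (permute_list p xs) (permute_list q ys) \<le> wasserstein1_list d xs ys"
proof -
  obtain r where r: "r permutes {..<length xs}"
    "wasserstein1_list d xs ys = (1 / real (length xs)) * (\<Sum>i<length xs. d (xs ! i) (ys ! r i))"
    using wasserstein1_list_attained .
  define t where "t = inv q \<circ> r \<circ> p"
  have t: "t permutes {..<length xs}"
    unfolding t_def using p q r len by (intro permutes_compose permutes_inv) auto
  have "(\<Sum>i<length xs. d (permute_list p xs ! i) (permute_list q ys ! t i))
      = (\<Sum>i<length xs. d (xs ! p i) (ys ! r (p i)))"
  proof (intro sum.cong refl)
    fix i assume i: "i \<in> {..<length xs}"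
    then have "t i \<in> {..<length ys}" using t len permutes_in_image by metis
    then show "d (permute_list p xs ! i) (permute_list q ys ! t i) = d (xs ! p i) (ys ! r (p i))"
      using i p q by (simp add: permute_list_nth t_def permutes_inverses)
  qed
  also have "\<dots> = (\<Sum>i<length xs. d (xs ! i) (ys ! r i))"
    using sum.permute[OF p, of "\<lambda>i. d (xs ! i) (ys ! r i)"] by (simp add: comp_def)
  finally show ?thesis
    using wasserstein1_list_le[of t "permute_list p xs" d "permute_list q ys"] t r by simp
qed

lemma wasserstein1_list_cong:
  assumes "mset xs = mset xs'" "mset ys = mset ys'" "length xs = length ys"
  shows "wasserstein1_list d xs ys = wasserstein1_list d xs' ys'"
proof -
  have le: "wasserstein1_list d us vs \<le> wasserstein1_list d us' vs'"
    if uv: "mset us = mset us'" "mset vs = mset vs'" "length us = length vs" for us us' vs vs' :: "'a list"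
  proof -
    obtain p where p: "p permutes {..<length us'}" "permute_list p us' = us"
      using mset_eq_permutation[OF uv(1)] .
    obtain q where q: "q permutes {..<length vs'}" "permute_list q vs' = vs"
      using mset_eq_permutation[OF uv(2)] .
    have "length us' = length vs'" using uv by (metis size_mset)
    then show ?thesis using wasserstein1_list_permute_le p q by metis
  qed
  have "length xs' = length ys'" using assms by (metis size_mset)
  then show ?thesis using le assms by (metis order_antisym)
qed

lemma wasserstein1_mset:
  assumes "length xs = length ys"
  shows "wasserstein1 d (mset xs) (mset ys) = wasserstein1_list d xs ys"
proof -
  have "mset (SOME us. mset us = mset xs) = mset xs" "mset (SOME us. mset us = mset ys) = mset ys"
    by (rule someI, rule refl)+
  moreover from this have "length (SOME us. mset us = mset xs) = length (SOME us. mset us = mset ys)"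
    using assms by (metis size_mset)
  ultimately show ?thesis
    unfolding wasserstein1_def using assms by (auto intro: wasserstein1_list_cong)
qed

lemma Metric_space_wasserstein1:
  assumes "Metric_space X d"
  shows "Metric_space (unordered_tuples k X) (wasserstein1 d)"
proof -
  interpret Metric_space X d by fact
  have nonneg': "0 \<le> wasserstein1_list d xs ys" for xs ys
    using wasserstein1_list_attained[where xs = xs and ys = ys and d = d] by (metis divide_nonneg_nonneg mult_nonneg_nonneg
        nonneg of_nat_0_le_iff sum_nonneg zero_le_one)
  have le_sym: "wasserstein1_list d ys xs \<le> wasserstein1_list d xs ys"
    if len: "length xs = length ys" for xs ys
  proof -
    obtain p where p: "p permutes {..<length xs}"
      "wasserstein1_list d xs ys = (1 / real (length xs)) * (\<Sum>i<length xs. d (xs ! i) (ys ! p i))"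
      using wasserstein1_list_attained .
    have "(\<Sum>i<length xs. d (xs ! i) (ys ! p i)) = (\<Sum>i<length xs. d (ys ! i) (xs ! inv p i))"
      using sum.permute[OF p(1), of "\<lambda>i. d (ys ! i) (xs ! inv p i)"] permutes_inverses[OF p(1)]
      by (simp add: comp_def commute)
    then show ?thesis
      using wasserstein1_list_le[of "inv p" ys d xs] permutes_inv[OF p(1)] p(2) len by simp
  qed
  have tri: "wasserstein1_list d xs zs \<le> wasserstein1_list d xs ys + wasserstein1_list d ys zs"
    if len: "length xs = length ys" "length ys = length zs"
      and X: "set xs \<subseteq> X" "set ys \<subseteq> X" "set zs \<subseteq> X" for xs ys zs
  proof -
    obtain p where p: "p permutes {..<length xs}"
      "wasserstein1_list d xs ys = (1 / real (length xs)) * (\<Sum>i<length xs. d (xs ! i) (ys ! p i))"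
      using wasserstein1_list_attained .
    obtain q where q: "q permutes {..<length ys}"
      "wasserstein1_list d ys zs = (1 / real (length ys)) * (\<Sum>i<length ys. d (ys ! i) (zs ! q i))"
      using wasserstein1_list_attained .
    have qp: "(q \<circ> p) permutes {..<length xs}"
      using p q len by (intro permutes_compose) auto
    have "(\<Sum>i<length xs. d (xs ! i) (zs ! (q \<circ> p) i))
        \<le> (\<Sum>i<length xs. d (xs ! i) (ys ! p i) + d (ys ! p i) (zs ! q (p i)))"
    proof (rule sum_mono)
      fix i assume i: "i \<in> {..<length xs}"
      then have "p i \<in> {..<length xs}" "q (p i) \<in> {..<length xs}"
        using p q len permutes_in_image by metis+
      then show "d (xs ! i) (zs ! (q \<circ> p) i) \<le> d (xs ! i) (ys ! p i) + d (ys ! p i) (zs ! q (p i))"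
        using i len X by (auto intro!: triangle dest: nth_mem)
    qed
    also have "\<dots> = (\<Sum>i<length xs. d (xs ! i) (ys ! p i)) + (\<Sum>i<length xs. d (ys ! i) (zs ! q i))"
      using sum.permute[OF p(1), of "\<lambda>i. d (ys ! i) (zs ! q i)"] by (simp add: sum.distrib comp_def)
    finally have "(1 / real (length xs)) * (\<Sum>i<length xs. d (xs ! i) (zs ! (q \<circ> p) i)) \<le>
        (1 / real (length xs)) *
        ((\<Sum>i<length xs. d (xs ! i) (ys ! p i)) + (\<Sum>i<length xs. d (ys ! i) (zs ! q i)))"
      by (rule mult_left_mono) simp
    then show ?thesis
      using wasserstein1_list_le[OF qp, of d zs] p(2) q(2) len by (simp add: distrib_left add_divide_distrib)
  qed
  have zero': "mset xs = mset ys"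
    if len: "length xs = length ys" and X: "set xs \<subseteq> X" "set ys \<subseteq> X"
      and 0: "wasserstein1_list d xs ys = 0" for xs ys
  proof (cases "xs = []")
    case False
    obtain p where p: "p permutes {..<length xs}"
      "wasserstein1_list d xs ys = (1 / real (length xs)) * (\<Sum>i<length xs. d (xs ! i) (ys ! p i))"
      using wasserstein1_list_attained .
    then have "(\<Sum>i<length xs. d (xs ! i) (ys ! p i)) = 0" using 0 False by simp
    then have *: "\<forall>i<length xs. d (xs ! i) (ys ! p i) = 0"
      by (subst (asm) sum_nonneg_eq_0_iff) auto
    have "xs = permute_list p ys"
    proof (rule nth_equalityI)
      fix i assume i: "i < length xs"
      then have "p i < length ys" using p(1) len permutes_in_image[OF p(1)] by force
      then have "xs ! i = ys ! p i" using * i X zero nth_mem by (metis subsetD)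
      then show "xs ! i = permute_list p ys ! i" using i p(1) len by (simp add: permute_list_nth)
    qed (simp add: len)
    then show ?thesis using p(1) len by simp
  qed (use len in simp)
  have zero_self: "wasserstein1_list d xs xs = 0" if "set xs \<subseteq> X" for xs
  proof -
    have "(\<Sum>i<length xs. d (xs ! i) (xs ! id i)) = 0"
      using that by (intro sum.neutral) (auto dest: nth_mem)
    then show ?thesis
      using wasserstein1_list_le[OF permutes_id, of d xs xs] nonneg'[of xs xs] by simp
  qed
  show ?thesis
  proof
    fix A B C :: "'a multiset"
    obtain xs ys zs where [simp]: "A = mset xs" "B = mset ys" "C = mset zs"
      by (metis ex_mset)
    show "0 \<le> wasserstein1 d A B"
      by (simp add: wasserstein1_def nonneg')
    show "wasserstein1 d A B = wasserstein1 d B A"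
    proof (cases "length xs = length ys")
      case True
      then show ?thesis using le_sym[of xs ys] le_sym[of ys xs] by (simp add: wasserstein1_mset)
    qed (simp add: wasserstein1_def)
    show "wasserstein1 d A B = 0 \<longleftrightarrow> A = B"
      if "A \<in> unordered_tuples k X" "B \<in> unordered_tuples k X"
    proof
      assume "A = B"
      then show "wasserstein1 d A B = 0"
        using that wasserstein1_mset[of ys ys d] zero_self[of ys] by (simp add: unordered_tuples_def)
    qed (use that zero'[of xs ys] in \<open>auto simp: unordered_tuples_def wasserstein1_mset\<close>)
    show "wasserstein1 d A C \<le> wasserstein1 d A B + wasserstein1 d B C"
      if "A \<in> unordered_tuples k X" "B \<in> unordered_tuples k X" "C \<in> unordered_tuples k X"
      using that tri[of xs ys zs] by (simp add: unordered_tuples_def wasserstein1_mset)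
  qed
qed

end

theory Submission
  imports Defs
begin

text \<open>
  Every Gaussian kernel \<open>exp (-t |x - y|\<^sup>2)\<close> on the Hilbert space is positive definite, and so is the
  kernel it induces on tuples by summing over all pairs of points. The associated squared distance
  \<open>D\<^sub>t\<close> of two tuples is at most \<open>t\<close> times a quantity controlled by an optimal matching. For the
  scales \<open>t\<^sub>n = \<delta>^(2n)\<close> with \<open>\<delta> = 1/(8k\<^sup>2)\<close>, the sum of all \<open>D\<^sub>t\<close> therefore converges, is the squared
  distance of a map into a Hilbert space, and is bounded above in terms of the Wasserstein distance.
  For the lower bound, each pair among the \<open>2k\<close> points spoils at most one scale, by having
  \<open>t\<^sub>n |x - y|\<^sup>2\<close> strictly between \<open>\<delta>\<close> and \<open>1/\<delta>\<close>. At any other scale the points fall into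
  well-separated clusters; unless the tuples can be matched within the clusters, some cluster
  contains unequally many points of the two, and then \<open>D\<^sub>t \<ge> 1/2\<close>. The number of scales without
  such a matching tends to infinity with the distance.
\<close>

section \<open>Positive definite kernels\<close>

text \<open>A list of weighted points, repetitions allowed, stands for a finitely supported signed
  measure; \<open>lin_comb\<close> integrates against it.\<close>

definition lin_comb :: "(real \<times> 's) list \<Rightarrow> ('s \<Rightarrow> real) \<Rightarrow> real" where
  "lin_comb c g = (\<Sum>(a, x)\<leftarrow>c. a * g x)"

definition scale_coeffs :: "real \<Rightarrow> (real \<times> 's) list \<Rightarrow> (real \<times> 's) list" where
  "scale_coeffs a c = map (\<lambda>(b, x). (a * b, x)) c"

definition kernel_form ::
    "('s \<Rightarrow> 's \<Rightarrow> real) \<Rightarrow> (real \<times> 's) list \<Rightarrow> (real \<times> 's) list \<Rightarrow> real" where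
  "kernel_form K c c' = lin_comb c (\<lambda>x. lin_comb c' (K x))"

definition pos_def :: "('s \<Rightarrow> 's \<Rightarrow> real) \<Rightarrow> bool" where
  "pos_def K \<longleftrightarrow> (\<forall>x y. K x y = K y x) \<and> (\<forall>c. 0 \<le> kernel_form K c c)"

lemma lin_comb_Nil [simp]: "lin_comb [] g = 0"
  and lin_comb_Cons [simp]: "lin_comb ((a, x) # c) g = a * g x + lin_comb c g"
  and lin_comb_append [simp]: "lin_comb (c @ c') g = lin_comb c g + lin_comb c' g"
  by (simp_all add: lin_comb_def)

lemma lin_comb_scale_coeffs [simp]: "lin_comb (scale_coeffs a c) g = a * lin_comb c g"
  by (induction c) (auto simp: scale_coeffs_def algebra_simps)

lemma lin_comb_add: "lin_comb c (\<lambda>x. g x + h x) = lin_comb c g + lin_comb c h"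
  by (induction c) (auto simp: algebra_simps)

lemma lin_comb_cmult: "lin_comb c (\<lambda>x. a * g x) = a * lin_comb c g"
  by (induction c) (auto simp: algebra_simps)

lemma lin_comb_diff: "lin_comb c (\<lambda>x. g x - h x) = lin_comb c g - lin_comb c h"
  by (induction c) (auto simp: algebra_simps)

lemma lin_comb_0 [simp]: "lin_comb c (\<lambda>x. 0) = 0"
  using lin_comb_cmult[of c 0 "\<lambda>x. 0"] by simp

lemma lin_comb_sum: "lin_comb c (\<lambda>x. \<Sum>i\<in>I. g i x) = (\<Sum>i\<in>I. lin_comb c (g i))"
  by (induction c) (auto simp: sum.distrib sum_distrib_left)

lemma lin_comb_swap:
  "lin_comb c (\<lambda>x. lin_comb c' (\<lambda>y. F x y)) = lin_comb c' (\<lambda>y. lin_comb c (\<lambda>x. F x y))"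
  by (induction c) (auto simp: lin_comb_add lin_comb_cmult)

lemma lin_comb_cong:
  assumes "\<And>x. x \<in> snd ` set c \<Longrightarrow> g x = h x"
  shows "lin_comb c g = lin_comb c h"
  using assms by (induction c) auto

lemma tendsto_lin_comb:
  assumes "\<And>x. ((\<lambda>n. g n x) \<longlongrightarrow> h x) F"
  shows "((\<lambda>n. lin_comb c (g n)) \<longlongrightarrow> lin_comb c h) F"
  by (induction c) (auto intro!: tendsto_intros assms)

lemma kernel_form_Nil [simp]: "kernel_form K [] c = 0" "kernel_form K c [] = 0"
  by (simp_all add: kernel_form_def)

lemma kernel_form_append_left: "kernel_form K (c @ c') e = kernel_form K c e + kernel_form K c' e"
  and kernel_form_append_right: "kernel_form K e (c @ c') = kernel_form K e c + kernel_form K e c'"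
  by (simp_all add: kernel_form_def lin_comb_add)

lemma kernel_form_scale_left: "kernel_form K (scale_coeffs a c) e = a * kernel_form K c e"
  and kernel_form_scale_right: "kernel_form K e (scale_coeffs a c) = a * kernel_form K e c"
  by (simp_all add: kernel_form_def lin_comb_cmult)

lemmas kernel_form_bilinear = kernel_form_append_left kernel_form_append_right
  kernel_form_scale_left kernel_form_scale_right

lemma pos_def_sym: "pos_def K \<Longrightarrow> K x y = K y x"
  by (simp add: pos_def_def)

lemma pos_def_nonneg: "pos_def K \<Longrightarrow> 0 \<le> kernel_form K c c"
  by (simp add: pos_def_def)

lemma kernel_form_sym: "pos_def K \<Longrightarrow> kernel_form K c c' = kernel_form K c' c"
  unfolding kernel_form_def by (subst lin_comb_swap) (simp add: pos_def_sym[of K])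

text \<open>Positivity of the form at c minus c' bounds the cross terms by the diagonal
  ones.\<close>

lemma kernel_form_append_le:
  assumes "pos_def K"
  shows "kernel_form K (c @ c') (c @ c') \<le> 2 * kernel_form K c c + 2 * kernel_form K c' c'"
  using pos_def_nonneg[OF assms, of "c @ scale_coeffs (-1) c'"] kernel_form_sym[OF assms, of c c']
  by (simp add: kernel_form_bilinear)

lemma pos_def_diag_nonneg: "pos_def K \<Longrightarrow> 0 \<le> K x x"
  using pos_def_nonneg[of K "[(1, x)]"] by (simp add: kernel_form_def)

lemma pos_def_abs_le:
  assumes "pos_def K"
  shows "\<bar>K x y\<bar> \<le> (K x x + K y y) / 2"
  using pos_def_nonneg[OF assms, of "[(1, x), (1, y)]"] pos_def_sym[OF assms, of x y]
    pos_def_nonneg[OF assms, of "[(1, x), (-1, y)]"]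
  by (simp add: kernel_form_def)

lemma pos_def_null:
  assumes "pos_def K" "K x x = 0"
  shows "K x y = 0"
proof (rule ccontr)
  assume nz: "K x y \<noteq> 0"
  \<comment> \<open>With this weight the form at a times x plus y takes the value -1.\<close>
  define a where "a = - (K y y + 1) / (2 * K x y)"
  have "0 \<le> 2 * a * K x y + K y y"
    using pos_def_nonneg[OF assms(1), of "[(a, x), (1, y)]"] assms(2) pos_def_sym[OF assms(1), of x y]
    by (simp add: kernel_form_def algebra_simps)
  moreover have "2 * a * K x y = - (K y y + 1)"
    using nz by (simp add: a_def)
  ultimately show False by simp
qed

section \<open>Closure properties of positive definite kernels\<close>

lemma pos_def_pullback:
  assumes "pos_def K"
  shows "pos_def (\<lambda>u v. kernel_form K (\<phi> u) (\<phi> v))"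
proof -
  \<comment> \<open>A combination of combinations flattens to one combination of points, where the
    form of \<open>K\<close> is nonnegative.\<close>
  define push where "push c = concat (map (\<lambda>(a, u). scale_coeffs a (\<phi> u)) c)" for c
  have push: "lin_comb c (\<lambda>u. lin_comb (\<phi> u) g) = lin_comb (push c) g" for c g
    by (induction c) (auto simp: push_def)
  have "kernel_form (\<lambda>u v. kernel_form K (\<phi> u) (\<phi> v)) c c = kernel_form K (push c) (push c)" for c
  proof -
    have "kernel_form (\<lambda>u v. kernel_form K (\<phi> u) (\<phi> v)) c c
        = lin_comb c (\<lambda>u. lin_comb (\<phi> u) (\<lambda>x. lin_comb c (\<lambda>v. lin_comb (\<phi> v) (K x))))"
      unfolding kernel_form_def by (subst lin_comb_swap) (rule refl)
    then show ?thesis by (simp add: push kernel_form_def)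
  qed
  then show ?thesis
    using assms kernel_form_sym[OF assms] by (simp add: pos_def_def)
qed

lemma pos_def_scale:
  assumes "pos_def K"
  shows "pos_def (\<lambda>x y. e x * e y * K x y)"
  using pos_def_pullback[OF assms, of "\<lambda>x. [(e x, x)]"] by (simp add: kernel_form_def mult.assoc)

lemma pos_def_cmult:
  assumes "pos_def K" "0 \<le> a"
  shows "pos_def (\<lambda>x y. a * K x y)"
  using assms by (simp add: pos_def_def kernel_form_def lin_comb_cmult)

lemma pos_def_const:
  assumes "0 \<le> a"
  shows "pos_def (\<lambda>(x :: 's) (y :: 's). a)"
proof -
  have const: "lin_comb c (\<lambda>x. b) = b * lin_comb c (\<lambda>x. 1)" for b and c :: "(real \<times> 's) list"
    using lin_comb_cmult[of c b "\<lambda>x. 1"] by simp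
  have "kernel_form (\<lambda>x y. a) c c = a * (lin_comb c (\<lambda>x. 1))\<^sup>2" for c :: "(real \<times> 's) list"
    unfolding kernel_form_def const[of c a] const[of c "a * lin_comb c (\<lambda>x. 1)"]
    by (simp add: power2_eq_square)
  then show ?thesis using assms by (simp add: pos_def_def)
qed

lemma pos_def_sum:
  assumes "\<And>i. i \<in> I \<Longrightarrow> pos_def (K i)"
  shows "pos_def (\<lambda>x y. \<Sum>i\<in>I. K i x y)"
  unfolding pos_def_def
proof (intro conjI allI)
  fix x y show "(\<Sum>i\<in>I. K i x y) = (\<Sum>i\<in>I. K i y x)"
    by (rule sum.cong) (auto intro: pos_def_sym assms)
next
  fix c show "0 \<le> kernel_form (\<lambda>x y. \<Sum>i\<in>I. K i x y) c c"
    unfolding kernel_form_def lin_comb_sum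
    by (rule sum_nonneg) (use assms pos_def_nonneg in \<open>auto simp: kernel_form_def\<close>)
qed

lemma pos_def_limit:
  assumes "\<And>n. pos_def (K n)" "\<And>x y. (\<lambda>n. K n x y) \<longlonglongrightarrow> L x y"
  shows "pos_def L"
  unfolding pos_def_def
proof (intro conjI allI)
  fix x y
  have "(\<lambda>n. K n x y) \<longlonglongrightarrow> L y x" using assms pos_def_sym[of "K _" x y] by simp
  then show "L x y = L y x" using assms(2) LIMSEQ_unique by blast
next
  fix c
  have "(\<lambda>n. kernel_form (K n) c c) \<longlonglongrightarrow> kernel_form L c c"
    unfolding kernel_form_def by (intro tendsto_lin_comb assms)
  then show "0 \<le> kernel_form L c c"
    by (rule LIMSEQ_le_const) (use assms pos_def_nonneg in blast)
qed

lemma pos_def_suminf: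
  assumes "\<And>n. pos_def (K n)" "\<And>x y. summable (\<lambda>n. K n x y)"
  shows "pos_def (\<lambda>x y. \<Sum>n. K n x y)"
  by (rule pos_def_limit[where K = "\<lambda>m x y. \<Sum>n<m. K n x y"])
    (auto intro: pos_def_sum assms summable_LIMSEQ)

text \<open>The Schur product theorem. Splitting off the row of the first point of the combination
  leaves a Schur complement, which is again positive definite and vanishes on that point.\<close>

lemma pos_def_mult:
  assumes "pos_def K" "pos_def L"
  shows "pos_def (\<lambda>x y. K x y * L x y)"
proof -
  have "0 \<le> kernel_form (\<lambda>x y. K x y * L x y) c c" for c
    using assms(1)
  proof (induction c arbitrary: K)
    case (Cons p c)
    obtain a x where p: "p = (a, x)" by fastforce
    \<comment> \<open>If \<open>K x x = 0\<close>, division by zero makes \<open>K' = K\<close>, and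
      the row of \<open>x\<close> already vanishes by \<open>pos_def_null\<close>.\<close>
    define K' where "K' = (\<lambda>y z. K y z - K x y * K x z / K x x)"
    have sym: "K y z = K z y" for y z using Cons.prems by (rule pos_def_sym)
    \<comment> \<open>The pullback replaces each point by its component orthogonal to
      \<open>x\<close> in the geometry of \<open>K\<close>.\<close>
    have "(\<lambda>y z. kernel_form K [(1, y), (- K x y / K x x, x)] [(1, z), (- K x z / K x x, x)]) = K'"
    proof (intro ext)
      fix y z
      show "kernel_form K [(1, y), (- K x y / K x x, x)] [(1, z), (- K x z / K x x, x)] = K' y z"
        using sym[of y x] by (cases "K x x = 0") (simp_all add: kernel_form_def K'_def field_simps)
    qed
    then have pd': "pos_def K'"
      using pos_def_pullback[OF Cons.prems, of "\<lambda>y. [(1, y), (- K x y / K x x, x)]"] by simp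
    have K'x: "K' x y = 0" "K' y x = 0" for y
      using pos_def_null[OF Cons.prems, of x] sym[of y x] by (cases "K x x = 0"; simp add: K'_def)+
    \<comment> \<open>The correction is \<open>L\<close> rescaled by the row \<open>K x\<close>, so
      its form is nonnegative by \<open>pos_def_scale\<close>.\<close>
    have K: "K y z * L y z = K' y z * L y z + 1 / K x x * (K x y * K x z * L y z)" for y z
      by (simp add: K'_def algebra_simps)
    have "kernel_form (\<lambda>y z. K y z * L y z) (p # c) (p # c)
        = kernel_form (\<lambda>y z. K' y z * L y z) (p # c) (p # c)
        + 1 / K x x * kernel_form (\<lambda>y z. K x y * K x z * L y z) (p # c) (p # c)"
      unfolding kernel_form_def K lin_comb_add lin_comb_cmult ..
    also have "kernel_form (\<lambda>y z. K' y z * L y z) (p # c) (p # c)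
        = kernel_form (\<lambda>y z. K' y z * L y z) c c"
      by (simp add: p kernel_form_def K'x)
    finally show ?case
      using Cons.IH[OF pd'] pos_def_nonneg[OF pos_def_scale[OF assms(2), of "K x"]]
        pos_def_diag_nonneg[OF Cons.prems, of x] by simp
  qed simp
  then show ?thesis using assms by (simp add: pos_def_def)
qed

lemma pos_def_power: "pos_def K \<Longrightarrow> pos_def (\<lambda>x y. K x y ^ n)"
  by (induction n) (auto intro: pos_def_mult pos_def_const)

text \<open>Partial sums of the exponential series are nonnegative combinations of Schur powers, and
  positivity passes to limits.\<close>

lemma pos_def_exp:
  assumes "pos_def K"
  shows "pos_def (\<lambda>x y. exp (K x y))"
proof -
  have "pos_def (\<lambda>x y. \<Sum>n. inverse (fact n) * K x y ^ n)"
    using summable_exp by (intro pos_def_suminf pos_def_cmult pos_def_power assms) auto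
  then show ?thesis by (simp add: exp_def)
qed

lemma (in real_inner_space) pos_def_inn:
  assumes "\<And>x. f x \<in> H"
  shows "pos_def (\<lambda>x y. inn (f x) (f y))"
proof -
  \<comment> \<open>The combination is evaluated inside \<open>H\<close>, so that its form becomes
    the squared norm of \<open>v c\<close>.\<close>
  define v where "v c = foldr (\<lambda>(a, x) w. add (scal a (f x)) w) c zero" for c
  have v_in: "v c \<in> H" for c
    by (induction c) (auto simp: v_def zero_closed intro!: add_closed scal_closed assms)
  have inn_zero: "inn zero u = 0" if "u \<in> H" for u
    using inn_add_left[OF zero_closed zero_closed that] add_zero[OF zero_closed] by simp
  have inn_v: "inn (v c) u = lin_comb c (\<lambda>x. inn (f x) u)" if "u \<in> H" for c u
  proof (induction c)
    case (Cons p c)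
    obtain a x where p: "p = (a, x)" by fastforce
    have "v (p # c) = add (scal a (f x)) (v c)" by (simp add: p v_def)
    then show ?case
      using Cons assms that v_in by (simp add: p inn_add_left inn_scal_left scal_closed)
  qed (simp add: v_def inn_zero that)
  have "kernel_form (\<lambda>x y. inn (f x) (f y)) c c = inn (v c) (v c)" for c
    using inn_v[OF assms] inn_v[OF v_in] inn_commute[OF assms v_in] inn_commute[OF assms assms]
    by (simp add: kernel_form_def)
  then show ?thesis
    using assms v_in by (simp add: pos_def_def inn_ge_zero inn_commute[of "f _" "f _"])
qed

section \<open>The reproducing kernel Hilbert space\<close>

text \<open>Functions are regarded as functionals on the finite combinations of points, which carry
  the quadratic form of \<open>K\<close>. The squared dual norm of \<open>g\<close> is written as
  \<open>sup\<^sub>c (2 \<langle>c, g\<rangle> - K(c, c))\<close>; this form makes the parallelogram law and completeness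
  immediate, and the inner product is then obtained by polarisation.\<close>

definition rkhs :: "('s \<Rightarrow> 's \<Rightarrow> real) \<Rightarrow> ('s \<Rightarrow> real) set" where
  "rkhs K = {g. bdd_above (range (\<lambda>c. 2 * lin_comb c g - kernel_form K c c))}"

definition rkhs_norm2 :: "('s \<Rightarrow> 's \<Rightarrow> real) \<Rightarrow> ('s \<Rightarrow> real) \<Rightarrow> real" where
  "rkhs_norm2 K g = (SUP c. 2 * lin_comb c g - kernel_form K c c)"

definition rkhs_inner :: "('s \<Rightarrow> 's \<Rightarrow> real) \<Rightarrow> ('s \<Rightarrow> real) \<Rightarrow> ('s \<Rightarrow> real) \<Rightarrow> real" where
  "rkhs_inner K g h =
     (rkhs_norm2 K (\<lambda>x. g x + h x) - rkhs_norm2 K (\<lambda>x. g x - h x)) / 4"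

text \<open>Subtracting a times \<open>\<phi> 1\<close> leaves an additive function that vanishes on
  the integers, hence is periodic and bounded. A nonzero value would grow without bound along its
  integer multiples.\<close>

lemma additive_bounded_imp_linear:
  fixes \<phi> :: "real \<Rightarrow> real"
  assumes add: "\<And>a b. \<phi> (a + b) = \<phi> a + \<phi> b"
    and bound: "\<And>a. \<lbrakk>0 \<le> a; a \<le> 1\<rbrakk> \<Longrightarrow> \<bar>\<phi> a\<bar> \<le> B"
  shows "\<phi> a = a * \<phi> 1"
proof -
  define \<psi> where "\<psi> b = \<phi> b - b * \<phi> 1" for b
  have \<psi>_add: "\<psi> (b + c) = \<psi> b + \<psi> c" for b c
    by (simp add: \<psi>_def add algebra_simps)
  have \<psi>_0: "\<psi> 0 = 0" using \<psi>_add[of 0 0] by simp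
  have \<psi>_mult: "\<psi> (real n * b) = real n * \<psi> b" for n b
    by (induction n) (simp_all add: \<psi>_0 \<psi>_add algebra_simps)
  have \<psi>_uminus: "\<psi> (- b) = - \<psi> b" for b
    using \<psi>_add[of b "- b"] \<psi>_0 by simp
  have "\<psi> 1 = 0" by (simp add: \<psi>_def)
  then have \<psi>_nat: "\<psi> (real n) = 0" for n
    using \<psi>_mult[of n 1] by simp
  have \<psi>_int: "\<psi> (of_int z) = 0" for z
    using \<psi>_nat \<psi>_uminus by (cases z rule: int_cases2) (auto simp: \<psi>_nat)
  have \<psi>_bound: "\<bar>\<psi> b\<bar> \<le> B + \<bar>\<phi> 1\<bar>" for b
  proof -
    have f: "0 \<le> frac b" "frac b \<le> 1" using frac_lt_1[of b] by auto
    have "\<psi> b = \<psi> (frac b)"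
      using \<psi>_add[of "of_int \<lfloor>b\<rfloor>" "frac b"] \<psi>_int by (simp add: frac_def)
    moreover have "\<bar>frac b * \<phi> 1\<bar> \<le> \<bar>\<phi> 1\<bar>"
      using f by (simp add: abs_mult mult_left_le_one_le)
    ultimately show ?thesis
      using bound[OF f] unfolding \<psi>_def by linarith
  qed
  have "\<psi> a = 0"
  proof (rule ccontr)
    assume "\<psi> a \<noteq> 0"
    then obtain n where "B + \<bar>\<phi> 1\<bar> < real n * \<bar>\<psi> a\<bar>"
      using reals_Archimedean3[of "\<bar>\<psi> a\<bar>"] by auto
    then show False
      using \<psi>_bound[of "real n * a"] by (simp add: \<psi>_mult abs_mult)
  qed
  then show ?thesis by (simp add: \<psi>_def)
qed

context
  fixes K :: "'s \<Rightarrow> 's \<Rightarrow> real"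
  assumes pd: "pos_def K"
begin

section \<open>The squared dual norm and its parallelogram law\<close>

lemma rkhs_norm2_upper:
  "g \<in> rkhs K \<Longrightarrow> 2 * lin_comb c g - kernel_form K c c \<le> rkhs_norm2 K g"
  unfolding rkhs_def rkhs_norm2_def by (auto intro: cSUP_upper)

lemma rkhs_norm2_least:
  assumes "\<And>c. 2 * lin_comb c g - kernel_form K c c \<le> b"
  shows "g \<in> rkhs K" "rkhs_norm2 K g \<le> b"
  using assms unfolding rkhs_def rkhs_norm2_def
  by (auto intro!: bdd_aboveI2[where M = b] cSUP_least)

lemma rkhs_norm2_nonneg: "g \<in> rkhs K \<Longrightarrow> 0 \<le> rkhs_norm2 K g"
  using rkhs_norm2_upper[of g "[]"] by simp

lemma rkhs_zero: "(\<lambda>x. 0) \<in> rkhs K" "rkhs_norm2 K (\<lambda>x. 0) = 0"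
proof -
  have *: "2 * lin_comb c (\<lambda>x. 0) - kernel_form K c c \<le> 0" for c
    using pos_def_nonneg[OF pd] by simp
  show 1: "(\<lambda>x. 0) \<in> rkhs K" by (rule rkhs_norm2_least(1)[OF *])
  show "rkhs_norm2 K (\<lambda>x. 0) = 0"
    using rkhs_norm2_least(2)[OF *] rkhs_norm2_nonneg[OF 1] by simp
qed

text \<open>Testing on \<open>c\<close> divided by \<open>a\<close> scales both terms of the
  supremum by the square of \<open>a\<close>.\<close>

lemma rkhs_scale_le:
  assumes "g \<in> rkhs K"
  shows "(\<lambda>x. a * g x) \<in> rkhs K" "rkhs_norm2 K (\<lambda>x. a * g x) \<le> a\<^sup>2 * rkhs_norm2 K g"
proof -
  have *: "2 * lin_comb c (\<lambda>x. a * g x) - kernel_form K c c \<le> a\<^sup>2 * rkhs_norm2 K g" for c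
  proof (cases "a = 0")
    case True
    then show ?thesis using pos_def_nonneg[OF pd] by simp
  next
    case False
    let ?c = "scale_coeffs (1 / a) c"
    have "2 * lin_comb c (\<lambda>x. a * g x) - kernel_form K c c
        = a\<^sup>2 * (2 * lin_comb ?c g - kernel_form K ?c ?c)"
      using False by (simp add: lin_comb_cmult kernel_form_bilinear power2_eq_square field_simps)
    then show ?thesis
      using rkhs_norm2_upper[OF assms, of ?c] by (simp add: mult_left_mono)
  qed
  show "(\<lambda>x. a * g x) \<in> rkhs K" by (rule rkhs_norm2_least(1)[OF *])
  show "rkhs_norm2 K (\<lambda>x. a * g x) \<le> a\<^sup>2 * rkhs_norm2 K g" by (rule rkhs_norm2_least(2)[OF *])
qed

lemma rkhs_norm2_scale:
  assumes "g \<in> rkhs K"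
  shows "rkhs_norm2 K (\<lambda>x. a * g x) = a\<^sup>2 * rkhs_norm2 K g"
proof (cases "a = 0")
  case False
  have "rkhs_norm2 K (\<lambda>x. 1 / a * (a * g x)) \<le> (1 / a)\<^sup>2 * rkhs_norm2 K (\<lambda>x. a * g x)"
    by (intro rkhs_scale_le assms)
  then have "a\<^sup>2 * rkhs_norm2 K g \<le> rkhs_norm2 K (\<lambda>x. a * g x)"
    using False by (simp add: power_divide field_simps)
  then show ?thesis using rkhs_scale_le(2)[OF assms, of a] by simp
qed (simp add: rkhs_zero)

lemma rkhs_norm2_uminus: "g \<in> rkhs K \<Longrightarrow> rkhs_norm2 K (\<lambda>x. - g x) = rkhs_norm2 K g"
  using rkhs_norm2_scale[of g "-1"] by simp

lemma rkhs_add: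
  assumes "g \<in> rkhs K" "h \<in> rkhs K"
  shows "(\<lambda>x. g x + h x) \<in> rkhs K"
proof (rule rkhs_norm2_least(1))
  fix c
  show "2 * lin_comb c (\<lambda>x. g x + h x) - kernel_form K c c
      \<le> 2 * rkhs_norm2 K g + 2 * rkhs_norm2 K h"
    using rkhs_norm2_upper[OF assms(1), of "scale_coeffs (1/2) c"]
      rkhs_norm2_upper[OF assms(2), of "scale_coeffs (1/2) c"]
    by (simp add: lin_comb_add kernel_form_bilinear)
qed

lemma rkhs_diff:
  assumes "g \<in> rkhs K" "h \<in> rkhs K"
  shows "(\<lambda>x. g x - h x) \<in> rkhs K"
  using rkhs_add[OF assms(1) rkhs_scale_le(1)[OF assms(2), of "-1"]] by simp

text \<open>Testing g on (c + c')/2 and h on (c - c')/2 yields the test values of g + h at c and of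
  g - h at c', because the form itself obeys the parallelogram law. The suprema over c and c' are
  taken one after the other.\<close>

lemma rkhs_parallelogram_le:
  assumes "g \<in> rkhs K" "h \<in> rkhs K"
  shows "rkhs_norm2 K (\<lambda>x. g x + h x) + rkhs_norm2 K (\<lambda>x. g x - h x)
    \<le> 2 * rkhs_norm2 K g + 2 * rkhs_norm2 K h"
proof -
  let ?b = "2 * rkhs_norm2 K g + 2 * rkhs_norm2 K h"
  have *: "2 * lin_comb c (\<lambda>x. g x + h x) - kernel_form K c c
      \<le> ?b - (2 * lin_comb c' (\<lambda>x. g x - h x) - kernel_form K c' c')" for c c'
    using rkhs_norm2_upper[OF assms(1), of "scale_coeffs (1/2) (c @ c')"]
      rkhs_norm2_upper[OF assms(2), of "scale_coeffs (1/2) (c @ scale_coeffs (-1) c')"]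
    by (simp add: lin_comb_add lin_comb_diff kernel_form_bilinear) (simp add: field_simps)
  have "2 * lin_comb c' (\<lambda>x. g x - h x) - kernel_form K c' c'
      \<le> ?b - rkhs_norm2 K (\<lambda>x. g x + h x)" for c'
    using rkhs_norm2_least(2)[OF *, of c'] by linarith
  from rkhs_norm2_least(2)[OF this] show ?thesis by linarith
qed

text \<open>The reverse inequality is the same bound for g + h and g - h, whose sum and difference
  are 2g and 2h.\<close>

lemma rkhs_parallelogram:
  assumes "g \<in> rkhs K" "h \<in> rkhs K"
  shows "rkhs_norm2 K (\<lambda>x. g x + h x) + rkhs_norm2 K (\<lambda>x. g x - h x)
    = 2 * rkhs_norm2 K g + 2 * rkhs_norm2 K h"
  using rkhs_parallelogram_le[OF assms]
    rkhs_parallelogram_le[OF rkhs_add[OF assms] rkhs_diff[OF assms]]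
    rkhs_norm2_scale[OF assms(1), of 2] rkhs_norm2_scale[OF assms(2), of 2]
  by (simp add: algebra_simps)

text \<open>Point evaluation is bounded, by testing on a multiple of the single point
  \<open>x\<close>. The added 1 keeps the denominator positive.\<close>

lemma rkhs_eval_le:
  assumes "g \<in> rkhs K"
  shows "(g x)\<^sup>2 \<le> (K x x + 1) * rkhs_norm2 K g"
proof -
  let ?k = "K x x"
  have k: "0 \<le> ?k" by (rule pos_def_diag_nonneg[OF pd])
  have "2 * (g x / (?k + 1)) * g x - (g x / (?k + 1))\<^sup>2 * ?k \<le> rkhs_norm2 K g"
    using rkhs_norm2_upper[OF assms, of "[(g x / (?k + 1), x)]"]
    by (simp add: kernel_form_def power2_eq_square mult.assoc)
  moreover have "(g x)\<^sup>2 / (?k + 1) \<le> 2 * (g x / (?k + 1)) * g x - (g x / (?k + 1))\<^sup>2 * ?k"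
  proof -
    have "2 * (g x / (?k + 1)) * g x - (g x / (?k + 1))\<^sup>2 * ?k - (g x)\<^sup>2 / (?k + 1)
        = (g x)\<^sup>2 / (?k + 1)\<^sup>2"
      using k by (simp add: divide_simps power2_eq_square) (simp add: algebra_simps)
    then show ?thesis by (smt (verit) divide_nonneg_nonneg zero_le_power2)
  qed
  ultimately have "(g x)\<^sup>2 / (?k + 1) \<le> rkhs_norm2 K g" by linarith
  then show ?thesis using k by (simp add: divide_le_eq mult.commute)
qed

lemma rkhs_norm2_eq_0:
  assumes "g \<in> rkhs K" "rkhs_norm2 K g = 0"
  shows "g = (\<lambda>x. 0)"
  using rkhs_eval_le[OF assms(1)] assms(2) by auto

section \<open>The inner product by polarisation\<close>

lemma rkhs_inner_self: "g \<in> rkhs K \<Longrightarrow> rkhs_inner K g g = rkhs_norm2 K g"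
  using rkhs_norm2_scale[of g 2] by (simp add: rkhs_inner_def rkhs_zero mult_2[symmetric])

lemma rkhs_inner_commute:
  assumes "g \<in> rkhs K" "h \<in> rkhs K"
  shows "rkhs_inner K g h = rkhs_inner K h g"
  using rkhs_norm2_uminus[OF rkhs_diff[OF assms]] by (simp add: rkhs_inner_def add.commute)

text \<open>The parallelogram law for g + u and h, minus the one for g - u and h.\<close>

lemma rkhs_inner_add_diff:
  assumes "g \<in> rkhs K" "h \<in> rkhs K" "u \<in> rkhs K"
  shows "rkhs_inner K (\<lambda>x. g x + h x) u + rkhs_inner K (\<lambda>x. g x - h x) u = 2 * rkhs_inner K g u"
proof -
  have eqs: "(\<lambda>x. g x + h x + u x) = (\<lambda>x. g x + u x + h x)" "(\<lambda>x. g x + h x - u x) = (\<lambda>x. g x - u x + h x)"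
    "(\<lambda>x. g x - h x + u x) = (\<lambda>x. g x + u x - h x)" "(\<lambda>x. g x - h x - u x) = (\<lambda>x. g x - u x - h x)"
    by (simp_all add: algebra_simps)
  show ?thesis
    using rkhs_parallelogram[OF rkhs_add[OF assms(1,3)] assms(2)]
      rkhs_parallelogram[OF rkhs_diff[OF assms(1,3)] assms(2)]
    unfolding rkhs_inner_def eqs by (simp add: field_simps)
qed

lemma rkhs_inner_zero: "u \<in> rkhs K \<Longrightarrow> rkhs_inner K (\<lambda>x. 0) u = 0"
  by (simp add: rkhs_inner_def rkhs_norm2_uminus)

lemma rkhs_inner_add:
  assumes "g \<in> rkhs K" "h \<in> rkhs K" "u \<in> rkhs K"
  shows "rkhs_inner K (\<lambda>x. g x + h x) u = rkhs_inner K g u + rkhs_inner K h u"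
proof -
  \<comment> \<open>In these terms g = v + w and h = v - w, so \<open>rkhs_inner_add_diff\<close> at
    v, w and at v, v gives additivity.\<close>
  define v w where "v = (\<lambda>x. 1/2 * (g x + h x))" and "w = (\<lambda>x. 1/2 * (g x - h x))"
  have vw: "v \<in> rkhs K" "w \<in> rkhs K"
    unfolding v_def w_def by (intro rkhs_scale_le rkhs_add rkhs_diff assms)+
  have "(\<lambda>x. v x + w x) = g" "(\<lambda>x. v x - w x) = h" "(\<lambda>x. v x + v x) = (\<lambda>x. g x + h x)"
    by (auto simp: v_def w_def field_simps)
  then show ?thesis
    using rkhs_inner_add_diff[OF vw assms(3)] rkhs_inner_add_diff[OF vw(1) vw(1) assms(3)]
      rkhs_inner_zero[OF assms(3)] by simp
qed

lemma rkhs_inner_scale: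
  assumes "g \<in> rkhs K" "u \<in> rkhs K"
  shows "rkhs_inner K (\<lambda>x. a * g x) u = a * rkhs_inner K g u"
proof -
  \<comment> \<open>Additivity in the scalar, with a bound on the unit interval from the
    parallelogram law, gives linearity.\<close>
  define \<phi> where "\<phi> b = rkhs_inner K (\<lambda>x. b * g x) u" for b
  have "\<phi> a = a * \<phi> 1"
  proof (rule additive_bounded_imp_linear)
    fix b c
    show "\<phi> (b + c) = \<phi> b + \<phi> c"
      using rkhs_inner_add[OF rkhs_scale_le(1)[OF assms(1), of b] rkhs_scale_le(1)[OF assms(1), of c] assms(2)]
      by (simp add: \<phi>_def algebra_simps)
  next
    fix b :: real assume b: "0 \<le> b" "b \<le> 1"
    let ?p = "rkhs_norm2 K (\<lambda>x. b * g x + u x)" and ?m = "rkhs_norm2 K (\<lambda>x. b * g x - u x)"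
    have bg: "(\<lambda>x. b * g x) \<in> rkhs K" by (intro rkhs_scale_le assms)
    have "?p + ?m = 2 * (b\<^sup>2 * rkhs_norm2 K g) + 2 * rkhs_norm2 K u"
      using rkhs_parallelogram[OF bg assms(2)] by (simp add: rkhs_norm2_scale assms)
    moreover have "b\<^sup>2 * rkhs_norm2 K g \<le> rkhs_norm2 K g"
      using b rkhs_norm2_nonneg[OF assms(1)] by (simp add: mult_left_le_one_le power_le_one)
    moreover have "0 \<le> ?p" "0 \<le> ?m"
      by (intro rkhs_norm2_nonneg rkhs_add rkhs_diff bg assms)+
    ultimately show "\<bar>\<phi> b\<bar> \<le> rkhs_norm2 K g + rkhs_norm2 K u"
      unfolding \<phi>_def rkhs_inner_def by (simp add: abs_le_iff)
  qed
  then show ?thesis by (simp add: \<phi>_def)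
qed

lemma rkhs_hdist:
  assumes "g \<in> rkhs K" "h \<in> rkhs K"
  shows "hdist (\<lambda>g h x. g x + h x) (\<lambda>a g x. a * g x) (rkhs_inner K) g h
    = sqrt (rkhs_norm2 K (\<lambda>x. g x - h x))"
  using rkhs_inner_self[OF rkhs_diff[OF assms]] by (simp add: hdist_def)

section \<open>Hilbert space axioms and completeness\<close>

lemma real_hilbert_space_rkhs:
  "real_hilbert_space (rkhs K) (\<lambda>g h x. g x + h x) (\<lambda>x. 0) (\<lambda>a g x. a * g x) (rkhs_inner K)"
    (is "real_hilbert_space _ ?add _ ?scal _")
proof unfold_locales
  fix s :: "nat \<Rightarrow> 's \<Rightarrow> real"
  assume s: "\<forall>n. s n \<in> rkhs K"
    and "\<forall>e>0. \<exists>N. \<forall>m\<ge>N. \<forall>n\<ge>N. hdist ?add ?scal (rkhs_inner K) (s m) (s n) < e"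
  then have Cauchy: "\<exists>N. \<forall>m\<ge>N. \<forall>n\<ge>N. sqrt (rkhs_norm2 K (\<lambda>x. s m x - s n x)) < e" if "e > 0" for e
    using that by (simp add: rkhs_hdist)
  have eval: "\<bar>s m x - s n x\<bar> \<le> sqrt (K x x + 1) * sqrt (rkhs_norm2 K (\<lambda>x. s m x - s n x))" for m n x
    using rkhs_eval_le[OF rkhs_diff[of "s m" "s n"], of x] s
    by (metis real_sqrt_abs real_sqrt_le_mono real_sqrt_mult)
  \<comment> \<open>The candidate limit is pointwise; boundedness of evaluation makes the values at
    each point Cauchy.\<close>
  define l where "l x = lim (\<lambda>n. s n x)" for x
  have lim: "(\<lambda>n. s n x) \<longlonglongrightarrow> l x" for x
  proof -
    have "Cauchy (\<lambda>n. s n x)"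
      unfolding Cauchy_def
    proof (intro allI impI)
      fix e :: real assume e: "e > 0"
      have k: "sqrt (K x x + 1) > 0" using pos_def_diag_nonneg[OF pd, of x] by simp
      then obtain N where N: "\<forall>m\<ge>N. \<forall>n\<ge>N. sqrt (rkhs_norm2 K (\<lambda>x. s m x - s n x)) < e / sqrt (K x x + 1)"
        using Cauchy[of "e / sqrt (K x x + 1)"] e by auto
      have "dist (s m x) (s n x) < e" if "m \<ge> N" "n \<ge> N" for m n
      proof -
        have "sqrt (K x x + 1) * sqrt (rkhs_norm2 K (\<lambda>x. s m x - s n x)) < e"
          using N that k by (metis pos_less_divide_eq mult.commute)
        then show ?thesis using eval[where m = m and n = n and x = x] by (simp add: dist_real_def)
      qed
      then show "\<exists>M. \<forall>m\<ge>M. \<forall>n\<ge>M. dist (s m x) (s n x) < e" by blast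
    qed
    then show ?thesis
      unfolding l_def by (simp add: Cauchy_convergent_iff convergent_LIMSEQ_iff)
  qed
  \<comment> \<open>Each test inequality involves finitely many points, so it survives the pointwise
    limit; the supremum over \<open>c\<close> then bounds the norm.\<close>
  have ev: "\<exists>N. \<forall>n\<ge>N. (\<lambda>x. s n x - l x) \<in> rkhs K \<and> rkhs_norm2 K (\<lambda>x. s n x - l x) \<le> e\<^sup>2"
    if e: "e > 0" for e
  proof -
    obtain N where N: "\<forall>m\<ge>N. \<forall>n\<ge>N. sqrt (rkhs_norm2 K (\<lambda>x. s m x - s n x)) < e"
      using Cauchy[OF e] by blast
    have "2 * lin_comb c (\<lambda>x. s n x - l x) - kernel_form K c c \<le> e\<^sup>2" if n: "n \<ge> N" for n c
    proof (rule LIMSEQ_le_const2)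
      show "(\<lambda>m. 2 * lin_comb c (\<lambda>x. s n x - s m x) - kernel_form K c c)
          \<longlonglongrightarrow> 2 * lin_comb c (\<lambda>x. s n x - l x) - kernel_form K c c"
        by (intro tendsto_intros tendsto_lin_comb lim)
      have "2 * lin_comb c (\<lambda>x. s n x - s m x) - kernel_form K c c \<le> e\<^sup>2" if m: "m \<ge> N" for m
      proof -
        have "rkhs_norm2 K (\<lambda>x. s n x - s m x) < e\<^sup>2"
          using N n m e by (metis real_sqrt_less_iff real_sqrt_unique less_imp_le)
        then show ?thesis
          using rkhs_norm2_upper[OF rkhs_diff[of "s n" "s m"], of c] s by fastforce
      qed
      then show "\<exists>N. \<forall>m\<ge>N. 2 * lin_comb c (\<lambda>x. s n x - s m x) - kernel_form K c c \<le> e\<^sup>2" by blast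
    qed
    then show ?thesis using rkhs_norm2_least by blast
  qed
  obtain n where "(\<lambda>x. s n x - l x) \<in> rkhs K" using ev[of 1] by auto
  then have l: "l \<in> rkhs K"
    using rkhs_diff[of "s n" "\<lambda>x. s n x - l x"] s by simp
  have "(\<lambda>n. hdist ?add ?scal (rkhs_inner K) (s n) l) \<longlonglongrightarrow> 0"
  proof (rule LIMSEQ_I)
    fix r :: real assume r: "r > 0"
    obtain N where N: "\<forall>n\<ge>N. rkhs_norm2 K (\<lambda>x. s n x - l x) \<le> (r/2)\<^sup>2"
      using ev[of "r/2"] r by auto
    have "norm (hdist ?add ?scal (rkhs_inner K) (s n) l - 0) < r" if "n \<ge> N" for n
    proof -
      have "sqrt (rkhs_norm2 K (\<lambda>x. s n x - l x)) \<le> r/2"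
        using N that r by (intro real_le_lsqrt) auto
      then show ?thesis
        using r s l rkhs_norm2_nonneg[OF rkhs_diff[of "s n" l]] by (simp add: rkhs_hdist)
    qed
    then show "\<exists>N. \<forall>n\<ge>N. norm (hdist ?add ?scal (rkhs_inner K) (s n) l - 0) < r" by blast
  qed
  with l show "\<exists>l\<in>rkhs K. (\<lambda>n. hdist ?add ?scal (rkhs_inner K) (s n) l) \<longlonglongrightarrow> 0" by blast
qed (auto simp: rkhs_zero rkhs_inner_self rkhs_inner_add rkhs_inner_scale algebra_simps
    intro: rkhs_add rkhs_scale_le rkhs_inner_commute rkhs_norm2_nonneg dest: rkhs_norm2_eq_0)

section \<open>The canonical feature map\<close>

lemma kernel_in_rkhs: "K x \<in> rkhs K"
proof (rule rkhs_norm2_least(1))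
  fix c
  show "2 * lin_comb c (K x) - kernel_form K c c \<le> K x x"
    using pos_def_nonneg[OF pd, of "[(1, x)] @ scale_coeffs (-1) c"] kernel_form_sym[OF pd, of c "[(1, x)]"]
    by (simp add: kernel_form_bilinear del: append_Cons append_Nil) (simp add: kernel_form_def)
qed

text \<open>The supremum is attained at the combination x minus y; positivity at its difference with
  c gives the upper bound.\<close>

lemma rkhs_norm2_kernel_diff: "rkhs_norm2 K (\<lambda>z. K x z - K y z) = K x x + K y y - 2 * K x y"
proof (rule antisym)
  define e where "e = [(1 :: real, x), (-1, y)]"
  have sym: "K y x = K x y" by (rule pos_def_sym[OF pd])
  have e_form: "kernel_form K e c = lin_comb c (\<lambda>z. K x z - K y z)" for c
    by (simp add: e_def kernel_form_def lin_comb_diff)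
  have ee: "kernel_form K e e = K x x + K y y - 2 * K x y"
    by (simp add: e_def kernel_form_def sym)
  show "rkhs_norm2 K (\<lambda>z. K x z - K y z) \<le> K x x + K y y - 2 * K x y"
  proof (rule rkhs_norm2_least(2))
    fix c
    show "2 * lin_comb c (\<lambda>z. K x z - K y z) - kernel_form K c c \<le> K x x + K y y - 2 * K x y"
      using pos_def_nonneg[OF pd, of "e @ scale_coeffs (-1) c"] kernel_form_sym[OF pd, of c e] ee e_form[of e]
      by (simp add: kernel_form_bilinear e_form)
  qed
  show "K x x + K y y - 2 * K x y \<le> rkhs_norm2 K (\<lambda>z. K x z - K y z)"
    using rkhs_norm2_upper[OF rkhs_diff[OF kernel_in_rkhs[of x] kernel_in_rkhs[of y]], of e]
      ee e_form[of e] by simp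
qed

text \<open>Each \<open>x\<close> goes to the function \<open>K x\<close>, so the carrier consists
  of real functions on the index type, as the theorem demands for multisets.\<close>

lemma pos_def_feature_map:
  obtains H :: "('s \<Rightarrow> real) set" and add zero scal inn \<Phi> where
    "real_hilbert_space H add zero scal inn" "\<And>x. \<Phi> x \<in> H"
    "\<And>x y. hdist add scal inn (\<Phi> x) (\<Phi> y) = sqrt (K x x + K y y - 2 * K x y)"
  using that[OF real_hilbert_space_rkhs, of K] kernel_in_rkhs
  by (simp add: rkhs_hdist rkhs_norm2_kernel_diff)

end

section \<open>Energy of a pair of tuples\<close>

definition diff_comb :: "'a list \<Rightarrow> 'a list \<Rightarrow> (real \<times> 'a) list" where
  "diff_comb xs ys = map (Pair 1) xs @ map (Pair (-1)) ys"

text \<open>The squared maximum mean discrepancy of the two tuples, without normalisation.\<close>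

definition energy :: "('a \<Rightarrow> 'a \<Rightarrow> real) \<Rightarrow> 'a list \<Rightarrow> 'a list \<Rightarrow> real" where
  "energy K xs ys = kernel_form K (diff_comb xs ys) (diff_comb xs ys)"

lemma lin_comb_diff_comb:
  "lin_comb (diff_comb xs ys) g = sum_list (map g xs) - sum_list (map g ys)"
proof -
  have "lin_comb (map (Pair a) zs) g = a * sum_list (map g zs)" for a zs
    by (induction zs) (auto simp: algebra_simps)
  then show ?thesis by (simp add: diff_comb_def)
qed

text \<open>Only the functional of a list matters, so points may be reordered and cancelling pairs
  inserted.\<close>

lemma kernel_form_cong:
  assumes "\<And>g. lin_comb c g = lin_comb c' g"
  shows "kernel_form K c c = kernel_form K c' c'"
  by (simp add: kernel_form_def assms)

lemma energy_nonneg: "pos_def K \<Longrightarrow> 0 \<le> energy K xs ys"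
  by (simp add: energy_def pos_def_nonneg)

lemma energy_mset_cong:
  assumes "mset ys = mset ys'"
  shows "energy K xs ys = energy K xs ys'"
proof -
  have "sum_list (map g ys) = sum_list (map g ys')" for g :: "'a \<Rightarrow> real"
    using assms by (metis mset_map sum_mset_sum_list)
  then show ?thesis
    unfolding energy_def by (intro kernel_form_cong) (simp add: lin_comb_diff_comb)
qed

text \<open>The base tuple \<open>zs\<close> cancels, so subtracting it does not change squared
  distances.\<close>

lemma energy_polarization:
  assumes "pos_def K"
  shows "kernel_form K (diff_comb xs zs) (diff_comb xs zs) + kernel_form K (diff_comb ys zs) (diff_comb ys zs)
      - 2 * kernel_form K (diff_comb xs zs) (diff_comb ys zs) = energy K xs ys"
proof -
  have "energy K xs ys = kernel_form K (diff_comb xs zs @ scale_coeffs (-1) (diff_comb ys zs))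
      (diff_comb xs zs @ scale_coeffs (-1) (diff_comb ys zs))"
    unfolding energy_def by (rule kernel_form_cong) (simp add: lin_comb_diff_comb)
  then show ?thesis
    using kernel_form_sym[OF assms, of "diff_comb xs zs" "diff_comb ys zs"]
    by (simp add: kernel_form_bilinear)
qed

definition sqdist :: "('a \<Rightarrow> 'a \<Rightarrow> real) \<Rightarrow> 'a \<Rightarrow> 'a \<Rightarrow> real" where
  "sqdist K x y = K x x + K y y - 2 * K x y"

lemma sqdist_self [simp]: "sqdist K x x = 0"
  by (simp add: sqdist_def)

lemma sqdist_commute: "pos_def K \<Longrightarrow> sqdist K x y = sqdist K y x"
  by (simp add: sqdist_def pos_def_sym[of K x y])

lemma sqdist_eq_kernel_form:
  "pos_def K \<Longrightarrow> sqdist K x y = kernel_form K [(1, x), (-1, y)] [(1, x), (-1, y)]"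
  by (simp add: sqdist_def kernel_form_def pos_def_sym[of K x y])

lemma sqdist_nonneg: "pos_def K \<Longrightarrow> 0 \<le> sqdist K x y"
  by (simp add: sqdist_eq_kernel_form pos_def_nonneg del: lin_comb_Cons)

text \<open>A cancelling pair at \<open>y\<close> is inserted; the factor 2 is that of
  \<open>kernel_form_append_le\<close>.\<close>

lemma sqdist_triangle:
  assumes "pos_def K"
  shows "sqdist K x z \<le> 2 * sqdist K x y + 2 * sqdist K y z"
proof -
  have "sqdist K x z = kernel_form K ([(1, x), (-1, y)] @ [(1, y), (-1, z)]) ([(1, x), (-1, y)] @ [(1, y), (-1, z)])"
    unfolding sqdist_eq_kernel_form[OF assms] by (rule kernel_form_cong) simp
  then show ?thesis
    using kernel_form_append_le[OF assms] by (simp only: sqdist_eq_kernel_form[OF assms])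
qed

lemma energy_le:
  assumes "pos_def K" "length xs = length ys" "0 \<le> b"
    and "\<And>i. i < length xs \<Longrightarrow> sqdist K (xs ! i) (ys ! i) \<le> b"
  shows "energy K xs ys \<le> 2 ^ Suc (length xs) * b"
proof -
  \<comment> \<open>The subtracted term lets the induction close: one more pair turns a bound E into
    2E + 2b.\<close>
  have "energy K xs ys \<le> 2 ^ Suc (length xs) * b - 2 * b"
    using assms(2,4)
  proof (induction xs ys rule: list_induct2)
    case Nil
    then show ?case by (simp add: energy_def diff_comb_def)
  next
    case (Cons x xs y ys)
    have "energy K (x # xs) (y # ys)
        = kernel_form K ([(1, x), (-1, y)] @ diff_comb xs ys) ([(1, x), (-1, y)] @ diff_comb xs ys)"
      unfolding energy_def by (rule kernel_form_cong) (simp add: lin_comb_diff_comb)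
    also have "\<dots> \<le> 2 * sqdist K x y + 2 * energy K xs ys"
      using kernel_form_append_le[OF assms(1)] by (simp only: sqdist_eq_kernel_form[OF assms(1)] energy_def)
    also have "energy K xs ys \<le> 2 ^ Suc (length xs) * b - 2 * b"
    proof (rule Cons.IH)
      show "sqdist K (xs ! i) (ys ! i) \<le> b" if "i < length xs" for i
        using Cons.prems[of "Suc i"] that by simp
    qed
    also have "sqdist K x y \<le> b" using Cons.prems[of 0] by simp
    finally show ?case by (simp add: algebra_simps)
  qed
  then show ?thesis using assms(3) by linarith
qed

section \<open>Lower bounds for the energy\<close>

lemma energy_equivalence_kernel:
  assumes "mset (map h xs) \<noteq> mset (map h ys)"
  shows "1 \<le> energy (\<lambda>x y. of_bool (h x = h y)) xs ys"
proof -
  define V where "V = set xs \<union> set ys"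
  let ?c = "diff_comb xs ys"
  let ?ind = "\<lambda>C x. of_bool (h x = C) :: real"
  have supp: "snd ` set ?c = V" by (simp add: diff_comb_def V_def image_Un image_image)
  \<comment> \<open>Splitting the kernel by classes turns the energy into the sum of squared
    differences of class counts.\<close>
  have ind: "(of_bool (h x = h y) :: real) = (\<Sum>C\<in>h ` V. ?ind C x * ?ind C y)" if "x \<in> V" for x y
  proof -
    have "(\<Sum>C\<in>h ` V. ?ind C x * ?ind C y) = (\<Sum>C\<in>h ` V. if h x = C then ?ind C y else 0)"
      by (intro sum.cong) auto
    then show ?thesis using that by (auto simp: V_def)
  qed
  have "energy (\<lambda>x y. of_bool (h x = h y)) xs ys
      = lin_comb ?c (\<lambda>x. lin_comb ?c (\<lambda>y. \<Sum>C\<in>h ` V. ?ind C x * ?ind C y))"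
    unfolding energy_def kernel_form_def
    by (rule lin_comb_cong) (simp add: supp ind)
  also have "\<dots> = (\<Sum>C\<in>h ` V. lin_comb ?c (\<lambda>x. lin_comb ?c (?ind C) * ?ind C x))"
    by (simp only: lin_comb_sum lin_comb_cmult mult.commute)
  also have "\<dots> = (\<Sum>C\<in>h ` V. (lin_comb ?c (?ind C))\<^sup>2)"
    by (simp only: lin_comb_cmult power2_eq_square)
  finally have eq: "energy (\<lambda>x y. of_bool (h x = h y)) xs ys = (\<Sum>C\<in>h ` V. (lin_comb ?c (?ind C))\<^sup>2)" .
  have cnt: "lin_comb ?c (?ind C) = of_int (int (count (mset (map h xs)) C) - int (count (mset (map h ys)) C))" for C
  proof -
    have "sum_list (map (?ind C) zs) = real (count (mset (map h zs)) C)" for zs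
      by (induction zs) auto
    then show ?thesis by (simp add: lin_comb_diff_comb)
  qed
  obtain C where C: "count (mset (map h xs)) C \<noteq> count (mset (map h ys)) C"
    using assms multiset_eq_iff by blast
  have "C \<in> h ` V"
  proof (rule ccontr)
    assume "C \<notin> h ` V"
    then have "C \<notin># mset (map h xs)" "C \<notin># mset (map h ys)" by (auto simp: V_def)
    then have "count (mset (map h xs)) C = 0" "count (mset (map h ys)) C = 0"
      unfolding not_in_iff .
    with C show False by linarith
  qed
  then have "(lin_comb ?c (?ind C))\<^sup>2 \<le> energy (\<lambda>x y. of_bool (h x = h y)) xs ys"
    unfolding eq by (intro member_le_sum) (auto simp: V_def)
  \<comment> \<open>Counts are integers, so a nonzero difference has square at least 1.\<close>
  moreover have "1 \<le> (int (count (mset (map h xs)) C) - int (count (mset (map h ys)) C))\<^sup>2"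
    using C by (simp del: mset_map add: int_one_le_iff_zero_less)
  then have "1 \<le> (lin_comb ?c (?ind C))\<^sup>2"
    unfolding cnt by (metis of_int_1_le_iff of_int_power)
  ultimately show ?thesis by linarith
qed

lemma abs_lin_comb_diff_comb_le:
  assumes "\<And>x. x \<in> set xs \<union> set ys \<Longrightarrow> \<bar>g x\<bar> \<le> B"
  shows "\<bar>lin_comb (diff_comb xs ys) g\<bar> \<le> real (length xs + length ys) * B"
proof -
  have "\<bar>sum_list (map g zs)\<bar> \<le> real (length zs) * B" if "\<And>x. x \<in> set zs \<Longrightarrow> \<bar>g x\<bar> \<le> B" for zs
    using that
  proof (induction zs)
    case (Cons z zs)
    then have "\<bar>g z\<bar> \<le> B" "\<bar>sum_list (map g zs)\<bar> \<le> real (length zs) * B" by auto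
    then show ?case by (simp add: algebra_simps)
  qed simp
  from this[of xs] this[of ys] show ?thesis
    using assms by (simp add: lin_comb_diff_comb algebra_simps)
qed

lemma energy_perturbation:
  assumes "\<And>x y. \<lbrakk>x \<in> set xs \<union> set ys; y \<in> set xs \<union> set ys\<rbrakk> \<Longrightarrow> \<bar>K x y - L x y\<bar> \<le> \<delta>"
  shows "\<bar>energy K xs ys - energy L xs ys\<bar> \<le> (real (length xs + length ys))\<^sup>2 * \<delta>"
proof -
  let ?c = "diff_comb xs ys"
  have "energy K xs ys - energy L xs ys = lin_comb ?c (\<lambda>x. lin_comb ?c (\<lambda>y. K x y - L x y))"
    by (simp add: energy_def kernel_form_def lin_comb_diff)
  also have "\<bar>\<dots>\<bar> \<le> real (length xs + length ys) * (real (length xs + length ys) * \<delta>)"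
    by (intro abs_lin_comb_diff_comb_le assms)
  finally show ?thesis by (simp add: power2_eq_square mult.assoc)
qed

text \<open>The gap hypothesis makes \<open>u x y \<le> \<delta>\<close> an equivalence relation on the points, and the Gaussian
  kernel is then close to the indicator of that relation, whose energy counts the excess of
  points of either tuple in each class.\<close>

lemma energy_gaussian_ge:
  fixes u :: "'a \<Rightarrow> 'a \<Rightarrow> real"
  assumes u: "\<And>x. u x x = 0" "\<And>x y. u x y = u y x" "\<And>x y z. u x z \<le> 2 * u x y + 2 * u y z"
    and \<delta>: "0 < \<delta>" "\<delta> \<le> 1 / 8" and len: "length xs = length ys"
    and gap: "\<And>x y. \<lbrakk>x \<in> set xs \<union> set ys; y \<in> set xs \<union> set ys\<rbrakk> \<Longrightarrow> u x y \<le> \<delta> \<or> 1 / \<delta> \<le> u x y"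
    and nonneg: "\<And>x y. 0 \<le> u x y"
    and no_match: "\<And>p. p permutes {..<length ys} \<Longrightarrow> \<exists>i<length ys. \<delta> < u (xs ! i) (ys ! p i)"
  shows "1 - (real (length xs + length ys))\<^sup>2 * \<delta> \<le> energy (\<lambda>x y. exp (- u x y)) xs ys"
proof -
  define V where "V = set xs \<union> set ys"
  define h where "h x = {y \<in> V. u x y \<le> \<delta>}" for x
  \<comment> \<open>Two near steps give at most \<open>4 * \<delta>\<close>, which lies below the
    far threshold; the gap then forces nearness, hence transitivity.\<close>
  have "4 * \<delta> * \<delta> \<le> 4 * (1/8) * (1/8)"
    using \<delta> by (intro mult_mono) auto
  then have gap_size: "4 * \<delta> < 1 / \<delta>"
    using \<delta> by (simp add: less_divide_eq)
  have near_trans: "u x z \<le> \<delta>" if "u x y \<le> \<delta>" "u y z \<le> \<delta>" "x \<in> V" "z \<in> V" for x y z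
    using u(3)[of x z y] that gap[of x z] gap_size unfolding V_def by linarith
  have h_eq: "h x = h y \<longleftrightarrow> u x y \<le> \<delta>" if "x \<in> V" "y \<in> V" for x y
  proof
    assume "h x = h y"
    moreover have "y \<in> h y" using that \<delta> u(1) by (simp add: h_def)
    ultimately have "y \<in> h x" by simp
    then show "u x y \<le> \<delta>" by (simp add: h_def)
  next
    assume xy: "u x y \<le> \<delta>"
    then have "u y x \<le> \<delta>" by (simp add: u(2)[of y x])
    with xy show "h x = h y"
      unfolding h_def using that near_trans by blast
  qed
  \<comment> \<open>Equal multisets of classes would provide a permutation that matches all points
    within their classes.\<close>
  have "mset (map h xs) \<noteq> mset (map h ys)"
  proof
    assume "mset (map h xs) = mset (map h ys)"
    then obtain p where p: "p permutes {..<length ys}" "permute_list p (map h ys) = map h xs"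
      by (metis length_map mset_eq_permutation)
    obtain i where i: "i < length ys" "\<delta> < u (xs ! i) (ys ! p i)"
      using no_match[OF p(1)] by blast
    have pi: "p i < length ys" using permutes_in_image[OF p(1), of i] i by simp
    have "map h xs ! i = permute_list p (map h ys) ! i" using p(2) by simp
    then have "h (xs ! i) = h (ys ! p i)"
      using i len p(1) pi by (simp add: permute_list_nth)
    then show False
      using h_eq[of "xs ! i" "ys ! p i"] i pi len by (auto simp: V_def)
  qed
  then have "1 \<le> energy (\<lambda>x y. of_bool (h x = h y)) xs ys"
    by (rule energy_equivalence_kernel)
  moreover have "\<bar>energy (\<lambda>x y. exp (- u x y)) xs ys - energy (\<lambda>x y. of_bool (h x = h y)) xs ys\<bar>
      \<le> (real (length xs + length ys))\<^sup>2 * \<delta>"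
  proof (rule energy_perturbation)
    fix x y assume xy: "x \<in> set xs \<union> set ys" "y \<in> set xs \<union> set ys"
    \<comment> \<open>Near pairs use 1 - u <= exp (-u) <= 1, far pairs use exp u >= 1 + u.\<close>
    show "\<bar>exp (- u x y) - of_bool (h x = h y)\<bar> \<le> \<delta>"
    proof (cases "u x y \<le> \<delta>")
      case True
      then show ?thesis
        using h_eq[of x y] xy nonneg[of x y] exp_ge_add_one_self[of "- u x y"] by (simp add: V_def)
    next
      case False
      have "1 / \<delta> \<le> exp (u x y)"
        using False gap[OF xy] exp_ge_add_one_self[of "u x y"] by linarith
      then have "exp (- u x y) \<le> \<delta>"
        using \<delta>(1) by (simp add: exp_minus field_simps)
      then show ?thesis using False h_eq[of x y] xy by (simp add: V_def)
    qed
  qed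
  ultimately show ?thesis by linarith
qed

section \<open>Summation over scales\<close>

definition gaussian :: "('a \<Rightarrow> 'a \<Rightarrow> real) \<Rightarrow> real \<Rightarrow> 'a \<Rightarrow> 'a \<Rightarrow> real" where
  "gaussian P t x y = exp (- (t * sqdist P x y))"

lemma pos_def_gaussian:
  assumes "pos_def P" "0 \<le> t"
  shows "pos_def (gaussian P t)"
proof -
  \<comment> \<open>Expanding the squared distance splits the Gaussian into two one-variable factors
    and the exponential of a multiple of \<open>P\<close>.\<close>
  have "pos_def (\<lambda>x y. exp (- t * P x x) * exp (- t * P y y) * exp ((2 * t) * P x y))"
    using assms by (intro pos_def_scale pos_def_exp pos_def_cmult) auto
  then show ?thesis
    by (simp add: gaussian_def[abs_def] sqdist_def exp_add[symmetric] algebra_simps)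
qed

lemma sqdist_gaussian_le: "sqdist (gaussian P t) x y \<le> 2 * (t * sqdist P x y)"
  using exp_ge_add_one_self[of "- (t * sqdist P x y)"]
  by (simp add: sqdist_def[of "gaussian P t"] gaussian_def)

lemma energy_gaussian_le:
  assumes "pos_def P" "0 \<le> t" "length xs = length ys" "0 \<le> b"
    and "\<And>i. i < length xs \<Longrightarrow> sqdist P (xs ! i) (ys ! i) \<le> b"
  shows "energy (gaussian P t) xs ys \<le> 2 ^ Suc (length xs) * (2 * b) * t"
proof -
  have "energy (gaussian P t) xs ys \<le> 2 ^ Suc (length xs) * (2 * (t * b))"
  proof (rule energy_le)
    fix i assume "i < length xs"
    then have "2 * (t * sqdist P (xs ! i) (ys ! i)) \<le> 2 * (t * b)"
      using assms by (simp add: mult_left_mono)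
    then show "sqdist (gaussian P t) (xs ! i) (ys ! i) \<le> 2 * (t * b)"
      by (rule order_trans[OF sqdist_gaussian_le])
  qed (use assms in \<open>simp_all add: pos_def_gaussian\<close>)
  then show ?thesis by (simp add: mult_ac)
qed

lemma summable_energy_gaussian:
  assumes "pos_def P" "length xs = length ys" "summable t" "\<And>n. 0 \<le> t n"
  shows "summable (\<lambda>n. energy (gaussian P (t n)) xs ys)"
proof (rule summable_comparison_test'[where N = 0])
  \<comment> \<open>Any finite bound gives convergence, so the lists are matched in their given
    order.\<close>
  define b where "b = (\<Sum>i<length xs. sqdist P (xs ! i) (ys ! i))"
  show "summable (\<lambda>n. 2 ^ Suc (length xs) * (2 * b) * t n)"
    by (intro summable_mult assms)
  have b: "0 \<le> b" "\<And>i. i < length xs \<Longrightarrow> sqdist P (xs ! i) (ys ! i) \<le> b"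
    unfolding b_def by (auto intro!: sum_nonneg member_le_sum sqdist_nonneg assms)
  show "norm (energy (gaussian P (t n)) xs ys) \<le> 2 ^ Suc (length xs) * (2 * b) * t n" for n
    using energy_gaussian_le[OF assms(1,4,2) b] energy_nonneg[OF pos_def_gaussian[OF assms(1,4)]]
    by simp
qed

text \<open>A later scale shrinks the value by at least the factor \<delta>^2, which takes anything
  below 1/\<delta> to below \<delta>.\<close>

lemma card_bad_scales_le:
  fixes \<delta> s :: real
  assumes "0 < \<delta>" "\<delta> < 1" "0 \<le> s"
  defines "B \<equiv> {n. \<delta> < \<delta> ^ (2 * n) * s \<and> \<delta> ^ (2 * n) * s < 1 / \<delta>}"
  shows "finite B" "card B \<le> 1"
proof -
  have "\<not> n < m" if "n \<in> B" "m \<in> B" for n m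
  proof
    assume "n < m"
    then have "\<delta> ^ (2 * m) \<le> \<delta> ^ (2 * n + 2)"
      using assms by (intro power_decreasing) auto
    then have "\<delta> ^ (2 * m) * s \<le> \<delta> ^ (2 * n + 2) * s"
      using assms(3) by (rule mult_right_mono)
    also have "\<dots> = \<delta>\<^sup>2 * (\<delta> ^ (2 * n) * s)"
      by (simp only: power_add mult_ac)
    also have "\<dots> \<le> \<delta>\<^sup>2 * (1 / \<delta>)"
      using that by (intro mult_left_mono) (auto simp: B_def)
    also have "\<dots> = \<delta>" using assms by (simp add: power2_eq_square)
    finally show False using that by (simp add: B_def)
  qed
  then have "\<exists>n. B \<subseteq> {n}" by (metis insertCI linorder_neqE_nat subsetI)
  then obtain n where "B \<subseteq> {n}" by blast
  then show "finite B" "card B \<le> 1"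
    using finite_subset card_mono[of "{n}" B] by auto
qed

lemma suminf_energy_gaussian_ge:
  assumes P: "pos_def P" and k: "length xs = k" "length ys = k" "0 < k"
    and \<delta>: "\<delta> = 1 / (8 * (real k)\<^sup>2)"
    and no_match: "\<And>n p. \<lbrakk>n < N; p permutes {..<k}\<rbrakk>
      \<Longrightarrow> \<exists>i<k. \<delta> < \<delta> ^ (2 * n) * sqdist P (xs ! i) (ys ! p i)"
  shows "(real N - 4 * (real k)\<^sup>2) / 2 \<le> (\<Sum>n. energy (gaussian P (\<delta> ^ (2 * n))) xs ys)"
proof -
  define V where "V = set xs \<union> set ys"
  define B where "B x y = {n. \<delta> < \<delta> ^ (2 * n) * sqdist P x y \<and> \<delta> ^ (2 * n) * sqdist P x y < 1 / \<delta>}" for x y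
  \<comment> \<open>One scale at most per ordered pair of at most 2k points, hence the count
    4k^2.\<close>
  define bad where "bad = (\<Union>(x, y)\<in>V \<times> V. B x y)"
  let ?D = "\<lambda>n. energy (gaussian P (\<delta> ^ (2 * n))) xs ys"
  have "1 \<le> (real k)\<^sup>2" using k by simp
  then have d: "0 < \<delta>" "\<delta> \<le> 1 / 8"
    using k by (simp_all add: \<delta> divide_le_eq)
  have finV: "finite V" by (simp add: V_def)
  have B: "finite (B x y)" "card (B x y) \<le> 1" for x y
    unfolding B_def using card_bad_scales_le[of \<delta> "sqdist P x y"] d sqdist_nonneg[OF P] by auto
  have "card V \<le> 2 * k"
    using card_Un_le[of "set xs" "set ys"] card_length[of xs] card_length[of ys] k by (simp add: V_def)
  then have "card V * card V \<le> (2 * k) * (2 * k)" by (intro mult_mono) auto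
  moreover have "card bad \<le> (\<Sum>(x, y)\<in>V \<times> V. card (B x y))"
    unfolding bad_def using card_UN_le[of "V \<times> V" "\<lambda>(x, y). B x y"] finV
    by (simp add: case_prod_beta')
  moreover have "(\<Sum>(x, y)\<in>V \<times> V. card (B x y)) \<le> (\<Sum>(x, y)\<in>V \<times> V. 1)"
    by (intro sum_mono) (use B in auto)
  ultimately have "card bad \<le> (2 * k) * (2 * k)" by (simp add: card_cartesian_product)
  then have "real (card bad) \<le> real ((2 * k) * (2 * k))" by (rule of_nat_mono)
  then have bad: "real (card bad) \<le> 4 * (real k)\<^sup>2" by (simp add: power2_eq_square)
  have finbad: "finite bad" unfolding bad_def using finV B by auto
  have D_good: "1 / 2 \<le> ?D n" if n: "n \<in> {..<N} - bad" for n
  proof -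
    have "1 - (real (length xs + length ys))\<^sup>2 * \<delta>
        \<le> energy (\<lambda>x y. exp (- (\<delta> ^ (2 * n) * sqdist P x y))) xs ys"
    proof (rule energy_gaussian_ge)
      fix x y z
      show "\<delta> ^ (2 * n) * sqdist P x z
          \<le> 2 * (\<delta> ^ (2 * n) * sqdist P x y) + 2 * (\<delta> ^ (2 * n) * sqdist P y z)"
        using mult_left_mono[OF sqdist_triangle[OF P, of x z y], of "\<delta> ^ (2 * n)"] d
        by (simp add: algebra_simps)
      show "\<delta> ^ (2 * n) * sqdist P x y \<le> \<delta> \<or> 1 / \<delta> \<le> \<delta> ^ (2 * n) * sqdist P x y"
        if "x \<in> set xs \<union> set ys" "y \<in> set xs \<union> set ys"
        using n that unfolding bad_def B_def V_def by fastforce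
    qed (use k d n no_match in \<open>auto simp: sqdist_commute[OF P] intro!: mult_nonneg_nonneg sqdist_nonneg[OF P]\<close>)
    \<comment> \<open>This fixes the value of \<open>\<delta>\<close>: the perturbation error must
      leave half of the energy 1.\<close>
    moreover have "(real (length xs + length ys))\<^sup>2 * \<delta> = 1 / 2"
      using k by (simp add: \<delta> power2_eq_square field_simps)
    ultimately show ?thesis by (simp add: gaussian_def[abs_def])
  qed
  have D_nonneg: "0 \<le> ?D n" for n
    using d by (intro energy_nonneg pos_def_gaussian P) auto
  have sm: "summable ?D"
    using d k by (intro summable_energy_gaussian P) (auto simp: power_mult abs_square_less_1 intro!: summable_geometric)
  have "real N - 4 * (real k)\<^sup>2 \<le> real (card ({..<N} - bad))"
    using bad diff_card_le_card_Diff[OF finbad, of "{..<N}"] by simp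
  then have "(real N - 4 * (real k)\<^sup>2) / 2 \<le> (\<Sum>n\<in>{..<N} - bad. 1 / 2)" by simp
  also have "\<dots> \<le> (\<Sum>n\<in>{..<N} - bad. ?D n)" by (rule sum_mono) (rule D_good)
  also have "\<dots> \<le> (\<Sum>n. ?D n)" using sm D_nonneg by (intro sum_le_suminf) auto
  finally show ?thesis .
qed

section \<open>Coarse embedding of tuples\<close>

text \<open>The lower control function is the infimum of image distances over pairs at distance at
  least w. It is monotone by construction, and \<open>low\<close> drives it to infinity.\<close>

lemma coarse_embeddingI:
  assumes f: "f \<in> X \<rightarrow> Y" and dY: "\<And>x y. \<lbrakk>x \<in> X; y \<in> X\<rbrakk> \<Longrightarrow> 0 \<le> dY (f x) (f y)"
    and up: "rho \<in> {0..} \<rightarrow> {0..}" "mono_on {0..} rho"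
      "\<And>x y. \<lbrakk>x \<in> X; y \<in> X\<rbrakk> \<Longrightarrow> dY (f x) (f y) \<le> rho (dX x y)"
    and low: "\<And>m. \<exists>R. \<forall>x\<in>X. \<forall>y\<in>X. R < dX x y \<longrightarrow> m \<le> dY (f x) (f y)"
  shows "coarse_embedding X dX Y dY f"
proof -
  \<comment> \<open>The values \<open>w' \<ge> w\<close> keep the set nonempty when \<open>X\<close> is bounded.\<close>
  define S where "S w = {w..} \<union> {dY (f x) (f y) | x y. x \<in> X \<and> y \<in> X \<and> w \<le> dX x y}" for w
  have S_ne: "S w \<noteq> {}" for w by (auto simp: S_def)
  have S_nonneg: "0 \<le> v" if "v \<in> S w" "0 \<le> w" for v w
    using that dY by (auto simp: S_def)
  then have S_bdd: "bdd_below (S w)" if "0 \<le> w" for w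
    using that by (intro bdd_belowI) auto
  have "mono_on {0..} (\<lambda>w. Inf (S w))"
  proof (rule mono_onI)
    fix v w :: real assume "v \<in> {0..}" "v \<le> w"
    then show "Inf (S v) \<le> Inf (S w)"
      using S_bdd[of v] S_ne[of w] by (intro cInf_superset_mono) (fastforce simp: S_def)+
  qed
  moreover have "filterlim (\<lambda>w. Inf (S w)) at_top at_top"
    unfolding filterlim_at_top
  proof
    fix m
    obtain R where R: "\<And>x y. \<lbrakk>x \<in> X; y \<in> X; R < dX x y\<rbrakk> \<Longrightarrow> m \<le> dY (f x) (f y)"
      using low[of m] by blast
    have "m \<le> Inf (S w)" if "max R m < w" for w
    proof (rule cInf_greatest[OF S_ne])
      fix v assume "v \<in> S w"
      then show "m \<le> v" using that R by (fastforce simp: S_def)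
    qed
    then show "eventually (\<lambda>w. m \<le> Inf (S w)) at_top"
      using eventually_gt_at_top[of "max R m"] by (rule eventually_mono[rotated])
  qed
  moreover have "(\<lambda>w. Inf (S w)) \<in> {0..} \<rightarrow> {0..}"
    using S_nonneg S_ne by (auto intro!: cInf_greatest)
  moreover have "Inf (S (dX x y)) \<le> dY (f x) (f y)" if xy: "x \<in> X" "y \<in> X" for x y
  proof (intro cInf_lower bdd_belowI[where m = "min (dX x y) 0"])
    show "dY (f x) (f y) \<in> S (dX x y)" using xy by (auto simp: S_def)
    \<comment> \<open>At a negative argument w the set \<open>S w\<close> also contains negative
      numbers, but none below w.\<close>
    show "min (dX x y) 0 \<le> v" if "v \<in> S (dX x y)" for v
      using that dY by (fastforce simp: S_def)
  qed
  ultimately show ?thesis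
    unfolding coarse_embedding_def using f up by blast
qed

lemma (in real_inner_space) hdist_eq_sqdist:
  assumes "u \<in> H" "v \<in> H"
  shows "hdist add scal inn u v = sqrt (inn u u + inn v v - 2 * inn u v)"
proof -
  have v': "scal (-1) v \<in> H" using assms scal_closed by blast
  let ?w = "add u (scal (-1) v)"
  have w: "?w \<in> H" using assms v' add_closed by blast
  have "inn ?w ?w = inn u ?w - inn v ?w"
    using assms v' w by (simp add: inn_add_left inn_scal_left)
  also have "inn u ?w = inn u u - inn v u"
    using assms v' w inn_commute[of u ?w] by (simp add: inn_add_left inn_scal_left)
  also have "inn v ?w = inn u v - inn v v"
    using assms v' w inn_commute[of v ?w] by (simp add: inn_add_left inn_scal_left)
  finally show ?thesis
    using inn_commute[of u v] assms by (simp add: hdist_def Let_def)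
qed

theorem theorem2:
  fixes X :: "'a set" and d :: "'a \<Rightarrow> 'a \<Rightarrow> real" and k :: nat
  assumes "Metric_space X d"
    and "coarsely_embeds_into_hilbert TYPE('h) X d"
    and "k > 0"
  shows "coarsely_embeds_into_hilbert TYPE('a multiset \<Rightarrow> real)
           (unordered_tuples k X) (wasserstein1 d)"
proof -
  interpret X: Metric_space X d by fact
  obtain H :: "'h set" and add zero scal inn f where
    Hil: "real_hilbert_space H add zero scal inn" and
    ce: "coarse_embedding X d H (hdist add scal inn) f"
    using assms(2) unfolding coarsely_embeds_into_hilbert_def by blast
  interpret H: real_hilbert_space H add zero scal inn by fact
  obtain rho_m rho_p :: "real \<Rightarrow> real" where
    f: "f \<in> X \<rightarrow> H" and
    rho_p: "rho_p \<in> {0..} \<rightarrow> {0..}" "mono_on {0..} rho_p" and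
    rho_m: "filterlim rho_m at_top at_top" and
    rho: "\<And>x y. \<lbrakk>x \<in> X; y \<in> X\<rbrakk> \<Longrightarrow> rho_m (d x y) \<le> hdist add scal inn (f x) (f y)"
      "\<And>x y. \<lbrakk>x \<in> X; y \<in> X\<rbrakk> \<Longrightarrow> hdist add scal inn (f x) (f y) \<le> rho_p (d x y)"
    using ce unfolding coarse_embedding_def by blast

  \<comment> \<open>Positive definiteness concerns the whole type, so \<open>f\<close> is extended
    by \<open>zero\<close> outside \<open>X\<close>.\<close>
  define F where "F x = (if x \<in> X then f x else zero)" for x
  define P where "P x y = inn (F x) (F y)" for x y
  have FH: "F x \<in> H" for x using f H.zero_closed by (auto simp: F_def)
  have P: "pos_def P" unfolding P_def[abs_def] by (rule H.pos_def_inn[OF FH])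
  have sqrt_P: "sqrt (sqdist P x y) = hdist add scal inn (f x) (f y)" if "x \<in> X" "y \<in> X" for x y
    using H.hdist_eq_sqdist[OF FH FH, of x y] that by (simp add: sqdist_def P_def F_def)

  define \<delta> where "\<delta> = 1 / (8 * (real k)\<^sup>2)"
  have "1 \<le> (real k)\<^sup>2" using assms(3) by simp
  then have \<delta>: "0 < \<delta>" "\<delta> \<le> 1 / 8"
    using assms(3) by (simp_all add: \<delta>_def divide_le_eq)
  define t where "t n = \<delta> ^ (2 * n)" for n
  have t: "0 \<le> t n" for n using \<delta> by (simp add: t_def)
  have t_sum: "summable t"
    unfolding t_def[abs_def] power_mult using \<delta> by (intro summable_geometric) (simp add: abs_square_less_1)
  have G: "pos_def (gaussian P (t n))" for n by (rule pos_def_gaussian[OF P t])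

  define S where "S = unordered_tuples k X"
  \<comment> \<open>The same choice as in \<open>wasserstein1\<close>, so that the distance unfolds
    to these enumerations.\<close>
  define L :: "'a multiset \<Rightarrow> 'a list" where "L A = (SOME xs. mset xs = A)" for A
  \<comment> \<open>If \<open>S\<close> is empty, \<open>A0\<close> is an arbitrary value that never
    enters \<open>\<phi>\<close>.\<close>
  define A0 where "A0 = (SOME A. A \<in> S)"
  have mset_L: "mset (L A) = A" for A
    unfolding L_def by (rule someI_ex) (rule ex_mset)
  have L: "length (L A) = k" "set (L A) \<subseteq> X" if "A \<in> S" for A
    using that mset_L[of A] unfolding S_def unordered_tuples_def
    by (metis (mono_tags, lifting) mem_Collect_eq size_mset, metis (mono_tags, lifting) mem_Collect_eq set_mset_mset)
  have A0: "A0 \<in> S" if "A \<in> S" for A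
    unfolding A0_def using that by (rule someI)
  have W: "wasserstein1 d A B = wasserstein1_list d (L A) (L B)" if "A \<in> S" "B \<in> S" for A B
    using that by (simp add: wasserstein1_def L_def S_def unordered_tuples_def)

  text \<open>Subtracting the base point \<open>A0\<close> makes the sum over scales converge.\<close>
  define \<phi> where "\<phi> A = (if A \<in> S then diff_comb (L A) (L A0) else [])" for A
  define K where "K A B = (\<Sum>n. kernel_form (gaussian P (t n)) (\<phi> A) (\<phi> B))" for A B
  define D where "D A B = (\<Sum>n. energy (gaussian P (t n)) (L A) (L B))" for A B
  have D_summable: "summable (\<lambda>n. energy (gaussian P (t n)) (L A) (L B))" if "A \<in> S" "B \<in> S" for A B
    using that L by (intro summable_energy_gaussian P t t_sum) auto
  have K_summable: "summable (\<lambda>n. kernel_form (gaussian P (t n)) (\<phi> A) (\<phi> B))" for A B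
  proof -
    \<comment> \<open>Diagonal terms are energies against \<open>A0\<close>, or 0 outside
      \<open>S\<close>; they dominate the others through \<open>pos_def_abs_le\<close>.\<close>
    have diag: "summable (\<lambda>n. kernel_form (gaussian P (t n)) (\<phi> A) (\<phi> A))" for A
      using D_summable[of A A0] A0[of A] by (cases "A \<in> S") (simp_all add: \<phi>_def energy_def)
    show ?thesis
    proof (rule summable_comparison_test'[where N = 0])
      show "summable (\<lambda>n. (kernel_form (gaussian P (t n)) (\<phi> A) (\<phi> A)
          + kernel_form (gaussian P (t n)) (\<phi> B) (\<phi> B)) / 2)"
        by (intro summable_divide summable_add diag)
    qed (use pos_def_abs_le[OF pos_def_pullback[OF G]] in auto)
  qed
  have pdK: "pos_def K"
    unfolding K_def[abs_def] by (intro pos_def_suminf pos_def_pullback G K_summable)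
  have K_D: "K A A + K B B - 2 * K A B = D A B" if AB: "A \<in> S" "B \<in> S" for A B
  proof -
    have "K A A + K B B - 2 * K A B = (\<Sum>n. kernel_form (gaussian P (t n)) (\<phi> A) (\<phi> A)
        + kernel_form (gaussian P (t n)) (\<phi> B) (\<phi> B) - 2 * kernel_form (gaussian P (t n)) (\<phi> A) (\<phi> B))"
      unfolding K_def
      using suminf_diff[OF summable_add[OF K_summable[of A A] K_summable[of B B]]
          summable_mult[OF K_summable[of A B], of 2]]
      by (simp add: suminf_add suminf_mult K_summable)
    also have "\<dots> = D A B"
      using AB by (simp add: \<phi>_def D_def energy_polarization[OF G])
    finally show ?thesis .
  qed
  obtain HH :: "('a multiset \<Rightarrow> real) set" and add' zero' scal' inn' \<Phi> where
    HH: "real_hilbert_space HH add' zero' scal' inn'" "\<And>A. \<Phi> A \<in> HH" and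
    dist\<Phi>: "\<And>A B. hdist add' scal' inn' (\<Phi> A) (\<Phi> B) = sqrt (K A A + K B B - 2 * K A B)"
    using pos_def_feature_map[OF pdK] by metis
  have dist_D: "hdist add' scal' inn' (\<Phi> A) (\<Phi> B) = sqrt (D A B)" if "A \<in> S" "B \<in> S" for A B
    using that by (simp add: dist\<Phi> K_D)
  have D_nonneg: "0 \<le> D A B" if "A \<in> S" "B \<in> S" for A B
    unfolding D_def using that by (intro suminf_nonneg D_summable energy_nonneg G)

  \<comment> \<open>The upper control function\<close>
  define C where "C = sqrt (2 ^ Suc k * 2 * suminf t)"
  \<comment> \<open>The total cost of an optimal matching is k times the Wasserstein distance and
    dominates each matched distance, hence the argument of \<open>rho_p\<close>.\<close>
  have upper: "sqrt (D A B) \<le> C * rho_p (real k * wasserstein1 d A B)" if AB: "A \<in> S" "B \<in> S" for A B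
  proof -
    let ?w = "real k * wasserstein1 d A B"
    obtain p where p: "p permutes {..<length (L A)}"
      "wasserstein1_list d (L A) (L B) = (1 / real (length (L A))) * (\<Sum>i<length (L A). d (L A ! i) (L B ! p i))"
      using wasserstein1_list_attained .
    then have w: "?w = (\<Sum>i<k. d (L A ! i) (L B ! p i))"
      using assms(3) by (simp add: W AB L)
    have in_X: "L A ! i \<in> X" "L B ! p i \<in> X" if "i < k" for i
      using that L[OF AB(1)] L[OF AB(2)] permutes_in_image[OF p(1), of i] by (auto intro: subsetD[OF _ nth_mem])
    have w0: "0 \<le> ?w" unfolding w by (intro sum_nonneg) simp
    have "sqdist P (L A ! i) (permute_list p (L B) ! i) \<le> (rho_p ?w)\<^sup>2" if i: "i < k" for i
    proof -
      have "d (L A ! i) (L B ! p i) \<le> ?w"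
        unfolding w using i by (intro member_le_sum) auto
      then have "rho_p (d (L A ! i) (L B ! p i)) \<le> rho_p ?w"
        using w0 by (intro mono_onD[OF rho_p(2)]) auto
      then have "sqrt (sqdist P (L A ! i) (L B ! p i)) \<le> rho_p ?w"
        using rho(2)[OF in_X[OF i]] sqrt_P[OF in_X[OF i]] by linarith
      then show ?thesis
        using sqrt_le_D p(1) i L AB by (simp add: permute_list_nth)
    qed
    \<comment> \<open>The energy ignores the order of the second list, so the optimal matching may
      be taken positionwise.\<close>
    then have le: "energy (gaussian P (t n)) (L A) (L B) \<le> 2 ^ Suc k * (2 * (rho_p ?w)\<^sup>2) * t n" for n
      using energy_gaussian_le[OF P t, of "L A" "permute_list p (L B)" "(rho_p ?w)\<^sup>2"] p(1) L AB
        energy_mset_cong[of "permute_list p (L B)" "L B"] by simp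
    have "D A B \<le> (\<Sum>n. 2 ^ Suc k * (2 * (rho_p ?w)\<^sup>2) * t n)"
      unfolding D_def by (intro suminf_le le D_summable AB summable_mult t_sum)
    also have "\<dots> = 2 ^ Suc k * 2 * suminf t * (rho_p ?w)\<^sup>2"
      unfolding suminf_mult[OF t_sum] by (simp add: mult_ac)
    finally have "sqrt (D A B) \<le> C * sqrt ((rho_p ?w)\<^sup>2)"
      unfolding C_def real_sqrt_mult[symmetric] by simp
    moreover have "0 \<le> rho_p ?w" using rho_p(1) w0 by auto
    ultimately show ?thesis by simp
  qed

  \<comment> \<open>The lower control function\<close>
  have lower: "\<exists>R. \<forall>A\<in>S. \<forall>B\<in>S. R < wasserstein1 d A B \<longrightarrow> m \<le> sqrt (D A B)" for m
  proof -
    \<comment> \<open>With so many scales the bound of \<open>suminf_energy_gaussian_ge\<close>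
      exceeds the square of \<open>m\<close>.\<close>
    obtain N where N: "4 * (real k)\<^sup>2 + 2 * m\<^sup>2 < real N"
      using reals_Archimedean2 by blast
    \<comment> \<open>The largest squared distance that still counts as near at scale
      \<open>N\<close>. Earlier scales have larger factors, so nearness at any of them also implies
      this bound.\<close>
    define b where "b = \<delta> / \<delta> ^ (2 * N)"
    have "eventually (\<lambda>r. sqrt b < rho_m r) at_top"
      using rho_m by (simp add: filterlim_at_top_dense)
    \<comment> \<open>Pairs with squared image distance at most \<open>b\<close> are closer than
      \<open>R\<close>.\<close>
    then obtain R where R: "\<And>r. R \<le> r \<Longrightarrow> sqrt b < rho_m r"
      by (auto simp: eventually_at_top_linorder)
    have "m \<le> sqrt (D A B)" if AB: "A \<in> S" "B \<in> S" and far: "R < wasserstein1 d A B" for A B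
    proof -
      have "(real N - 4 * (real k)\<^sup>2) / 2 \<le> (\<Sum>n. energy (gaussian P (\<delta> ^ (2 * n))) (L A) (L B))"
      proof (rule suminf_energy_gaussian_ge[OF P _ _ assms(3) \<delta>_def])
        fix n p assume n: "n < N" and p: "p permutes {..<k}"
        \<comment> \<open>Otherwise \<open>p\<close> matches all points within distance
          \<open>R\<close>, and the average cost, which bounds the Wasserstein distance, contradicts
          \<open>far\<close>.\<close>
        show "\<exists>i<k. \<delta> < \<delta> ^ (2 * n) * sqdist P (L A ! i) (L B ! p i)"
        proof (rule ccontr)
          assume "\<not> ?thesis"
          then have near: "\<delta> ^ (2 * n) * sqdist P (L A ! i) (L B ! p i) \<le> \<delta>" if "i < k" for i
            using that not_less by blast
          have "d (L A ! i) (L B ! p i) \<le> R" if i: "i < k" for i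
          proof -
            have in_X: "L A ! i \<in> X" "L B ! p i \<in> X"
              using i L[OF AB(1)] L[OF AB(2)] permutes_in_image[OF p, of i] by (auto intro: subsetD[OF _ nth_mem])
            have "\<delta> ^ (2 * N) \<le> \<delta> ^ (2 * n)"
              using n \<delta> by (intro power_decreasing) auto
            then have "\<delta> ^ (2 * N) * sqdist P (L A ! i) (L B ! p i)
                \<le> \<delta> ^ (2 * n) * sqdist P (L A ! i) (L B ! p i)"
              by (intro mult_right_mono sqdist_nonneg P)
            also have "\<dots> \<le> \<delta>" by (rule near[OF i])
            finally have "\<delta> ^ (2 * N) * sqdist P (L A ! i) (L B ! p i) \<le> \<delta>" .
            then have "sqdist P (L A ! i) (L B ! p i) \<le> b"
              using \<delta> by (simp add: b_def le_divide_eq mult.commute)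
            then have "rho_m (d (L A ! i) (L B ! p i)) \<le> sqrt b"
              using rho(1)[OF in_X] sqrt_P[OF in_X] by (metis order_trans real_sqrt_le_mono)
            then show ?thesis using R[of "d (L A ! i) (L B ! p i)"] by linarith
          qed
          then have "(\<Sum>i<k. d (L A ! i) (L B ! p i)) \<le> real k * R"
            using sum_bounded_above[of "{..<k}" "\<lambda>i. d (L A ! i) (L B ! p i)" R] by simp
          then have "1 / real k * (\<Sum>i<k. d (L A ! i) (L B ! p i)) \<le> R"
            using assms(3) by (simp add: divide_le_eq mult.commute)
          moreover have "wasserstein1 d A B \<le> 1 / real k * (\<Sum>i<k. d (L A ! i) (L B ! p i))"
            using wasserstein1_list_le[of p "L A" d "L B"] p AB L W by simp
          ultimately show False using far by linarith
        qed
      qed (use L AB in auto)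
      then have "m\<^sup>2 \<le> D A B" using N by (simp add: D_def t_def)
      then show ?thesis by (rule real_le_rsqrt)
    qed
    then show ?thesis by blast
  qed

  have "coarse_embedding S (wasserstein1 d) HH (hdist add' scal' inn') \<Phi>"
  proof (rule coarse_embeddingI[where rho = "\<lambda>w. C * rho_p (real k * w)"])
    have C: "0 \<le> C" unfolding C_def using suminf_nonneg[OF t_sum t] by simp
    show "(\<lambda>w. C * rho_p (real k * w)) \<in> {0..} \<rightarrow> {0..}"
      using C rho_p(1) by (auto intro!: mult_nonneg_nonneg)
    show "mono_on {0..} (\<lambda>w. C * rho_p (real k * w))"
      using C by (intro mono_onI mult_left_mono mono_onD[OF rho_p(2)]) auto
  qed (use HH(2) dist_D D_nonneg upper lower in auto)
  then show ?thesis
    unfolding coarsely_embeds_into_hilbert_def S_def using HH(1) by blast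
qed

end
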